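(* Let $V,U\ge 0$ be independent random variables with $\mathbb{E}[V]=\mathbb{E}[U]=1$, variances $\sigma_V^2,\sigma_U^2$ satisfying $0<\sigma_V^2+\sigma_U^2<\infty$, and such that for some $\delta>0$ the functions $z\mapsto \mathbb{E}[e^{zV}]$ and $z\mapsto\mathbb{E}[e^{zU}]$ are analytic in an open strip containing $-\delta\le \mathrm{Re}(z)\le\delta$. Let $\rho_n\in(0,1)$, $n=1,2,\dots$, be such that there are fixed $0<\beta_1\le\beta_2<\infty$ with $(1-\rho_n)\,n\in[\beta_1,\beta_2]$ for all $n$. Let $W_n$ be the steady-state waiting time of the nearly deterministic $\mathrm{GI}_n/\mathrm{G}_n/1$ queue built from $V,U,\rho_n$, and let $$\gamma_n=\frac{(\sigma_V^2+\rho_n^{-2}\sigma_U^2)\,\rho_n}{2n(1-\rho_n)} .$$ Then $$\mathbb{E}\big[e^{-tW_n}\big]=(1+\gamma_n t)^{-1}+O\Big(\frac{\log n}{\sqrt n}\Big),\qquad n\to\infty,$$ uniformly in any bounded set of complex $t$ with $\mathrm{Re}(t)\ge -1/(4\gamma_n)$. That is, for every bounded $T\subset\mathbb{C}$ there are constants $K<\infty$ and $n_0$ such that for all $n\ge n_0$ and all $t\in T$ with $\mathrm{Re}(t)\ge-1/(4\gamma_n)$ the expectation exists and the difference of the two transforms is at most $K\log n/\sqrt n$ in modulus.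
   Context: Nearly deterministic $\mathrm{GI}_n/\mathrm{G}_n/1$ queue: $V_n=\frac1n\sum_{k=1}^n V_{n,k}$ and $U_n=\frac1n\sum_{k=1}^nU_{n,k}$, where the $V_{n,k}$ are i.i.d. copies of $V$, the $U_{n,k}$ are i.i.d. copies of $U$, and all of these are independent. The steady-state waiting time $W_n\ge0$ is the (finite) random variable whose distribution is the stationary solution of $W_n\stackrel{d}{=}\big(W_n+V_n-\frac1{\rho_n}U_n\big)^+$, where $x^+=\max\{0,x\}$ and on the right-hand side $W_n,V_n,U_n$ are independent. *)

theory Defs
  imports "HOL-Probability.Probability" "HOL-Complex_Analysis.Complex_Analysis"
begin

text \<open>
  The Bochner integral of a non-integrable function is 0, so existence of \<open>E[e^(zX)]\<close> on the strip
  is demanded separately from analyticity.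
\<close>
definition mgf_analytic_on_strip :: "'a measure \<Rightarrow> ('a \<Rightarrow> real) \<Rightarrow> real \<Rightarrow> bool" where
  "mgf_analytic_on_strip M X \<delta> \<longleftrightarrow>
     (\<exists>a b. a < -\<delta> \<and> \<delta> < b \<and>
        (\<forall>z. a < Re z \<and> Re z < b \<longrightarrow> integrable M (\<lambda>\<omega>. exp (z * complex_of_real (X \<omega>)))) \<and>
        (\<lambda>z. \<integral>\<omega>. exp (z * complex_of_real (X \<omega>)) \<partial>M) analytic_on {z. a < Re z \<and> Re z < b})"

definition average :: "nat \<Rightarrow> (nat \<Rightarrow> 'a \<Rightarrow> real) \<Rightarrow> 'a \<Rightarrow> real" where
  "average n X \<omega> = (1 / real n) * (\<Sum>k=1..n. X k \<omega>)"

text \<open>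
  All \<open>2 n\<close> variables are jointly independent; the disjoint sum indexes the two families at once.
\<close>
definition iid_copies :: "'a measure \<Rightarrow> ('a \<Rightarrow> real) \<Rightarrow> ('a \<Rightarrow> real) \<Rightarrow> nat
    \<Rightarrow> (nat \<Rightarrow> 'a \<Rightarrow> real) \<Rightarrow> (nat \<Rightarrow> 'a \<Rightarrow> real) \<Rightarrow> bool" where
  "iid_copies M V U n Vs Us \<longleftrightarrow>
     (\<forall>k\<in>{1..n}. Vs k \<in> borel_measurable M \<and> distr M borel (Vs k) = distr M borel V) \<and>
     (\<forall>k\<in>{1..n}. Us k \<in> borel_measurable M \<and> distr M borel (Us k) = distr M borel U) \<and>
     prob_space.indep_vars M (\<lambda>_. borel) (case_sum Vs Us) ({1..n} <+> {1..n})"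

text \<open>
  Equality in law of \<open>W\<close> and \<open>(W + V - U / \<rho>)\<^sup>+\<close>. The product measure makes the three variables on
  the right-hand side independent, whatever their joint law on \<open>M\<close> is.
\<close>
definition steady_state_waiting_time ::
    "'a measure \<Rightarrow> ('a \<Rightarrow> real) \<Rightarrow> ('a \<Rightarrow> real) \<Rightarrow> real \<Rightarrow> ('a \<Rightarrow> real) \<Rightarrow> bool" where
  "steady_state_waiting_time M V U \<rho> W \<longleftrightarrow>
     W \<in> borel_measurable M \<and> (AE \<omega> in M. 0 \<le> W \<omega>) \<and>
     distr M borel W =
       distr (distr M borel W \<Otimes>\<^sub>M (distr M borel V \<Otimes>\<^sub>M distr M borel U)) borel
         (\<lambda>(w, v, u). max 0 (w + v - (1 / \<rho>) * u))"

definition gamma_scale :: "real \<Rightarrow> real \<Rightarrow> real \<Rightarrow> nat \<Rightarrow> real" where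
  "gamma_scale varV varU \<rho> n =
     ((varV + (1 / \<rho>\<^sup>2) * varU) * \<rho>) / (2 * real n * (1 - \<rho>))"

end

theory Submission
  imports Defs
begin

text \<open>
  With \<open>X = V\<^sub>n - U\<^sub>n / \<rho>\<^sub>n\<close> and idle time \<open>J = (W\<^sub>n + X)\<^sup>-\<close>, stationarity reads
  \<open>\<phi>(t) (1 - \<psi>(t)) = 1 - E[e^(t J)]\<close>, where \<open>\<phi>\<close> and \<open>\<psi>\<close> are the transforms of \<open>W\<^sub>n\<close> and \<open>X\<close>,
  and \<open>E[J] = - E[X] = \<epsilon>\<close>, which is of order \<open>1/n\<close>. A second-order expansion gives
  \<open>1 - \<psi>(t) = - \<epsilon> t (1 + \<gamma>\<^sub>n t + O(n^(-1/2)))\<close>. Since \<open>J \<le> \<bar>X\<bar>\<close> and \<open>\<surd>n X\<close> has exponential moments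
  bounded in \<open>n\<close>, splitting at \<open>J \<le> a\<close> with \<open>a\<close> a multiple of \<open>log n / \<surd>n\<close> gives
  \<open>1 - E[e^(t J)] = - \<epsilon> t (1 + O(log n / \<surd>n))\<close>. Dividing is harmless because
  \<open>Re (1 + \<gamma>\<^sub>n t) \<ge> 3/4\<close>; the same expansion at \<open>t = - 1/(4 \<gamma>\<^sub>n)\<close> shows \<open>\<psi>(t) < 1\<close>, which makes
  \<open>E[e^(- t W\<^sub>n)]\<close> finite.
\<close>

section \<open>Exponential estimates and transfer of integrals between equal laws\<close>

lemma power_le_fact_exp:
  fixes y :: real
  assumes "0 \<le> y"
  shows "y ^ k \<le> fact k * exp y"
proof -
  have "(\<Sum>i\<in>{k}. inverse (fact i) *\<^sub>R y ^ i) \<le> (\<Sum>i. inverse (fact i) *\<^sub>R y ^ i)"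
    using assms by (intro sum_le_suminf summable_exp_generic) auto
  then show ?thesis
    by (simp add: exp_def divide_simps mult.commute)
qed

text \<open>The power is paid for with half of the rate \<theta>, so that the other half stays free
  for a further exponential factor.\<close>

lemma power_le_const_exp:
  fixes x \<theta> :: real
  assumes "0 \<le> x" "0 < \<theta>"
  shows "x ^ k \<le> fact k * (2 / \<theta>) ^ k * exp (\<theta> * x / 2)"
proof -
  have "x ^ k = (2 / \<theta>) ^ k * (\<theta> * x / 2) ^ k"
    using assms by (simp flip: power_mult_distrib)
  also have "\<dots> \<le> (2 / \<theta>) ^ k * (fact k * exp (\<theta> * x / 2))"
    using assms by (intro mult_left_mono power_le_fact_exp) auto
  finally show ?thesis by (simp add: ac_simps)
qed

text \<open>Stated over a general normed field because it serves twice: for complex \<open>z\<close>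
  in the idle-time transform and for real \<open>z\<close> in the moment bounds for centred
  sums.\<close>

lemma exp_minus_two_terms_bound:
  fixes z :: "'a :: {banach, real_normed_field}"
  shows "norm (exp z - 1 - z) \<le> (norm z)\<^sup>2 * exp (norm z)"
proof -
  have "norm (exp z - (\<Sum>k\<le>1. z ^ k / fact k)) \<le> exp (norm z) * norm z ^ Suc 1 / fact 1"
    by (rule Taylor_exp_field)
  then show ?thesis by (simp add: algebra_simps numeral_2_eq_2)
qed

lemma exp_minus_three_terms_bound:
  "cmod (exp z - 1 - z - z\<^sup>2 / 2) \<le> cmod z ^ 3 * exp (cmod z) / 2"
proof -
  have "cmod (exp z - (\<Sum>k\<le>2. z ^ k / fact k)) \<le> exp (cmod z) * cmod z ^ Suc 2 / fact 2"
    by (rule Taylor_exp_field)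
  then show ?thesis by (simp add: algebra_simps numeral_2_eq_2 numeral_3_eq_3)
qed

text \<open>Both sides are the integral of \<open>f\<close> against the common law. The two spaces
  may differ: this exploits stationarity within one space and also moves results between
  \<open>M\<close> and an auxiliary product space.\<close>

lemma distr_eq_integral:
  fixes f :: "'b \<Rightarrow> 'c::{banach, second_countable_topology}"
  assumes [measurable]: "X \<in> measurable M N" "Y \<in> measurable M' N" "f \<in> borel_measurable N"
    and eq: "distr M N X = distr M' N Y"
  shows "(\<integral>\<omega>. f (X \<omega>) \<partial>M) = (\<integral>\<omega>. f (Y \<omega>) \<partial>M')"
    and "integrable M (\<lambda>\<omega>. f (X \<omega>)) \<longleftrightarrow> integrable M' (\<lambda>\<omega>. f (Y \<omega>))"
proof -
  have "(\<integral>\<omega>. f (X \<omega>) \<partial>M) = (\<integral>x. f x \<partial>distr M N X)"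
    by (simp add: integral_distr)
  then show "(\<integral>\<omega>. f (X \<omega>) \<partial>M) = (\<integral>\<omega>. f (Y \<omega>) \<partial>M')"
    unfolding eq by (simp add: integral_distr)
  have "integrable M (\<lambda>\<omega>. f (X \<omega>)) \<longleftrightarrow> integrable (distr M N X) f"
    by (simp add: integrable_distr_eq)
  then show "integrable M (\<lambda>\<omega>. f (X \<omega>)) \<longleftrightarrow> integrable M' (\<lambda>\<omega>. f (Y \<omega>))"
    unfolding eq by (simp add: integrable_distr_eq)
qed

context prob_space
begin

section \<open>Transform expansions under an exponential moment\<close>

text \<open>Since \<open>c\<close> is at most \<theta>/2, one half of the rate absorbs the factor
  \<open>exp (c * \<bar>X\<bar>)\<close> and the other half absorbs the power. With
  \<open>c = 0\<close> this yields the ordinary moments.\<close>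

lemma integrable_power_exp:
  fixes X :: "'a \<Rightarrow> real"
  assumes [measurable]: "X \<in> borel_measurable M"
    and int: "integrable M (\<lambda>\<omega>. exp (\<theta> * \<bar>X \<omega>\<bar>))" and "0 < \<theta>" "2 * c \<le> \<theta>"
  shows "integrable M (\<lambda>\<omega>. \<bar>X \<omega>\<bar> ^ k * exp (c * \<bar>X \<omega>\<bar>))"
    and "(\<integral>\<omega>. \<bar>X \<omega>\<bar> ^ k * exp (c * \<bar>X \<omega>\<bar>) \<partial>M)
      \<le> fact k * (2 / \<theta>) ^ k * expectation (\<lambda>\<omega>. exp (\<theta> * \<bar>X \<omega>\<bar>))"
proof -
  have b: "\<bar>X \<omega>\<bar> ^ k * exp (c * \<bar>X \<omega>\<bar>) \<le> fact k * (2 / \<theta>) ^ k * exp (\<theta> * \<bar>X \<omega>\<bar>)" for \<omega>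
  proof -
    have "2 * c * \<bar>X \<omega>\<bar> \<le> \<theta> * \<bar>X \<omega>\<bar>"
      using assms(4) by (rule mult_right_mono) simp
    then have "exp (c * \<bar>X \<omega>\<bar>) \<le> exp (\<theta> * \<bar>X \<omega>\<bar> / 2)"
      by simp
    then have "\<bar>X \<omega>\<bar> ^ k * exp (c * \<bar>X \<omega>\<bar>)
        \<le> (fact k * (2 / \<theta>) ^ k * exp (\<theta> * \<bar>X \<omega>\<bar> / 2)) * exp (\<theta> * \<bar>X \<omega>\<bar> / 2)"
      using assms(3) by (intro mult_mono power_le_const_exp) auto
    also have "\<dots> = fact k * (2 / \<theta>) ^ k * exp (\<theta> * \<bar>X \<omega>\<bar>)"
      by (simp flip: exp_add)
    finally show ?thesis .
  qed
  have i: "integrable M (\<lambda>\<omega>. fact k * (2 / \<theta>) ^ k * exp (\<theta> * \<bar>X \<omega>\<bar>))"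
    using int by simp
  show 1: "integrable M (\<lambda>\<omega>. \<bar>X \<omega>\<bar> ^ k * exp (c * \<bar>X \<omega>\<bar>))"
    by (rule Bochner_Integration.integrable_bound[OF i]) (use assms(3) b in \<open>auto simp: abs_mult\<close>)
  have "(\<integral>\<omega>. \<bar>X \<omega>\<bar> ^ k * exp (c * \<bar>X \<omega>\<bar>) \<partial>M) \<le> (\<integral>\<omega>. fact k * (2 / \<theta>) ^ k * exp (\<theta> * \<bar>X \<omega>\<bar>) \<partial>M)"
    by (intro integral_mono 1 i b)
  then show "(\<integral>\<omega>. \<bar>X \<omega>\<bar> ^ k * exp (c * \<bar>X \<omega>\<bar>) \<partial>M)
      \<le> fact k * (2 / \<theta>) ^ k * expectation (\<lambda>\<omega>. exp (\<theta> * \<bar>X \<omega>\<bar>))"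
    by simp
qed

text \<open>The dominated variable \<open>Y\<close> is either \<open>X\<close> itself or the idle
  time, which is at most \<bar>X\<bar> almost everywhere.\<close>

lemma integrable_exp_complex:
  fixes X Y :: "'a \<Rightarrow> real"
  assumes [measurable]: "X \<in> borel_measurable M" "Y \<in> borel_measurable M"
    and int: "integrable M (\<lambda>\<omega>. exp (c * \<bar>X \<omega>\<bar>))" and "cmod z \<le> c" "AE \<omega> in M. \<bar>Y \<omega>\<bar> \<le> \<bar>X \<omega>\<bar>"
  shows "integrable M (\<lambda>\<omega>. exp (z * complex_of_real (Y \<omega>)))"
proof (rule Bochner_Integration.integrable_bound[OF int])
  show "AE \<omega> in M. norm (exp (z * complex_of_real (Y \<omega>))) \<le> norm (exp (c * \<bar>X \<omega>\<bar>))"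
    using assms(5)
  proof eventually_elim
    case (elim \<omega>)
    have "Re (z * complex_of_real (Y \<omega>)) \<le> cmod z * \<bar>Y \<omega>\<bar>"
      using complex_Re_le_cmod[of "z * complex_of_real (Y \<omega>)"] by (simp add: norm_mult)
    also have "\<dots> \<le> c * \<bar>X \<omega>\<bar>"
      using elim assms(4) by (intro mult_mono) (auto intro: order_trans[OF norm_ge_zero])
    finally show ?case by (simp add: norm_exp_eq_Re)
  qed
qed simp

text \<open>The Taylor remainder is at most
  \<open>\<bar>z X\<bar>^3 exp \<bar>z X\<bar> / 2\<close>, and its expectation is controlled by the
  exponential moment. The constant 24 is \<open>3! * 2^3 / 2\<close>.\<close>

lemma transform_expansion:
  fixes X :: "'a \<Rightarrow> real" and z :: complex
  assumes [measurable]: "X \<in> borel_measurable M"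
    and int: "integrable M (\<lambda>\<omega>. exp (\<theta> * \<bar>X \<omega>\<bar>))" and "0 < \<theta>" "2 * cmod z \<le> \<theta>"
  shows "cmod ((\<integral>\<omega>. exp (z * complex_of_real (X \<omega>)) \<partial>M)
      - (1 + z * expectation X + z\<^sup>2 / 2 * expectation (\<lambda>\<omega>. (X \<omega>)\<^sup>2)))
    \<le> 24 / \<theta> ^ 3 * cmod z ^ 3 * expectation (\<lambda>\<omega>. exp (\<theta> * \<bar>X \<omega>\<bar>))"
proof -
  let ?f = "\<lambda>\<omega>. exp (z * complex_of_real (X \<omega>))"
  have "integrable M (\<lambda>\<omega>. \<bar>X \<omega>\<bar>)"
    using integrable_power_exp(1)[OF assms(1) int assms(3), of 0 1] assms(3) by simp
  then have iX: "integrable M X"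
    by (rule Bochner_Integration.integrable_bound) auto
  have iX2: "integrable M (\<lambda>\<omega>. (X \<omega>)\<^sup>2)"
    using integrable_power_exp(1)[OF assms(1) int assms(3), of 0 2] assms(3) by simp
  have iF: "integrable M ?f"
    using assms(4) norm_ge_zero[of z] assms(3)
    by (intro integrable_exp_complex[OF _ _ int]) auto
  have "(\<integral>\<omega>. exp (z * complex_of_real (X \<omega>)) \<partial>M)
      - (1 + z * expectation X + z\<^sup>2 / 2 * expectation (\<lambda>\<omega>. (X \<omega>)\<^sup>2))
    = (\<integral>\<omega>. ?f \<omega> - 1 - z * X \<omega> - (z\<^sup>2 / 2) * complex_of_real ((X \<omega>)\<^sup>2) \<partial>M)"
    using iF iX iX2 by (simp add: prob_space del: of_real_power)
  also have "cmod \<dots> \<le> (\<integral>\<omega>. cmod (?f \<omega> - 1 - z * X \<omega> - (z\<^sup>2 / 2) * complex_of_real ((X \<omega>)\<^sup>2)) \<partial>M)"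
    by (rule Bochner_Integration.integral_norm_bound)
  also have "\<dots> \<le> (\<integral>\<omega>. cmod z ^ 3 / 2 * (\<bar>X \<omega>\<bar> ^ 3 * exp (cmod z * \<bar>X \<omega>\<bar>)) \<partial>M)"
  proof (rule integral_mono)
    show "cmod (?f \<omega> - 1 - z * X \<omega> - (z\<^sup>2 / 2) * complex_of_real ((X \<omega>)\<^sup>2))
       \<le> cmod z ^ 3 / 2 * (\<bar>X \<omega>\<bar> ^ 3 * exp (cmod z * \<bar>X \<omega>\<bar>))" for \<omega>
      using exp_minus_three_terms_bound[of "z * X \<omega>"]
      by (simp add: norm_mult power_mult_distrib algebra_simps)
  qed (use iF iX iX2 integrable_power_exp(1)[OF assms(1) int assms(3,4), of 3] in \<open>auto simp del: of_real_power\<close>)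
  also have "\<dots> = cmod z ^ 3 / 2 * (\<integral>\<omega>. (\<bar>X \<omega>\<bar> ^ 3 * exp (cmod z * \<bar>X \<omega>\<bar>)) \<partial>M)"
    by simp
  also have "\<dots> \<le> cmod z ^ 3 / 2 * (fact 3 * (2 / \<theta>) ^ 3 * expectation (\<lambda>\<omega>. exp (\<theta> * \<bar>X \<omega>\<bar>)))"
    by (intro mult_left_mono integrable_power_exp(2)[OF assms(1) int assms(3,4)]) auto
  also have "\<dots> = 24 / \<theta> ^ 3 * cmod z ^ 3 * expectation (\<lambda>\<omega>. exp (\<theta> * \<bar>X \<omega>\<bar>))"
    by (simp add: fact_numeral power_divide)
  finally show ?thesis .
qed

text \<open>The remainder \<open>J^2 exp (\<bar>z\<bar> J)\<close> is split at \<open>a\<close>. Up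
  to \<open>a\<close> one factor \<open>J\<close> is kept, so that this part is proportional to
  \<open>E[J]\<close>; beyond \<open>a\<close> also \<bar>X\<bar> exceeds \<open>a\<close>, and the
  exponential moment of \<open>X\<close> makes this part exponentially small in \<open>a\<close>.
  The level \<open>a\<close> is left free to balance the two.\<close>

lemma idle_transform_expansion:
  fixes X J :: "'a \<Rightarrow> real" and z :: complex
  assumes [measurable]: "X \<in> borel_measurable M" "J \<in> borel_measurable M"
    and int: "integrable M (\<lambda>\<omega>. exp (\<theta> * \<bar>X \<omega>\<bar>))" and "0 < \<theta>" "4 * cmod z \<le> \<theta>" "0 \<le> a"
    and J: "AE \<omega> in M. 0 \<le> J \<omega> \<and> J \<omega> \<le> \<bar>X \<omega>\<bar>"
  shows "cmod ((\<integral>\<omega>. exp (z * complex_of_real (J \<omega>)) \<partial>M) - (1 + z * expectation J))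
    \<le> (cmod z)\<^sup>2 * (a * exp (cmod z * a) * expectation J
         + 8 / \<theta>\<^sup>2 * exp (- (\<theta> * a / 4)) * expectation (\<lambda>\<omega>. exp (\<theta> * \<bar>X \<omega>\<bar>)))"
proof -
  let ?c = "cmod z" and ?f = "\<lambda>\<omega>. exp (z * complex_of_real (J \<omega>))"
  have c: "?c \<le> \<theta>" using assms(5) norm_ge_zero[of z] by linarith
  have iX: "integrable M (\<lambda>\<omega>. \<bar>X \<omega>\<bar>)"
    using integrable_power_exp(1)[OF assms(1) int assms(4), of 0 1] assms(4) by simp
  have iJ: "integrable M J"
    by (rule Bochner_Integration.integrable_bound[OF iX]) (use J in auto)
  have iF: "integrable M ?f"
    using J c by (intro integrable_exp_complex[OF _ _ int]) auto
  define g where "g x = x\<^sup>2 * exp (?c * x)" for x :: real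
  define h where "h \<omega> = exp (- (\<theta> * a / 4)) * (\<bar>X \<omega>\<bar> ^ 2 * exp (\<theta> / 2 * \<bar>X \<omega>\<bar>))" for \<omega>
  have "integrable M (\<lambda>\<omega>. \<bar>X \<omega>\<bar> ^ 2 * exp (\<theta> / 2 * \<bar>X \<omega>\<bar>))"
    using assms(4) by (intro integrable_power_exp(1)[OF assms(1) int]) auto
  then have ih: "integrable M h"
    unfolding h_def by (rule integrable_mult_right)
  have gb: "AE \<omega> in M. g (J \<omega>) \<le> a * exp (?c * a) * J \<omega> + h \<omega>"
    using J
  proof eventually_elim
    case (elim \<omega>)
    have h0: "h \<omega> \<ge> 0" by (simp add: h_def)
    show ?case
    proof (cases "J \<omega> \<le> a")
      case True
      have "g (J \<omega>) = J \<omega> * exp (?c * J \<omega>) * J \<omega>" by (simp add: g_def power2_eq_square)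
      also have "\<dots> \<le> a * exp (?c * a) * J \<omega>"
        using elim True assms(6) by (intro mult_mono) (auto intro!: mult_left_mono)
      finally show ?thesis using h0 by simp
    next
      case False
      \<comment> \<open>One quarter of the rate bounds \<open>exp (\<bar>z\<bar> J)\<close>. A
        second quarter is added through \<open>\<theta>/4 * (\<bar>X\<bar> - a) \<ge> 0\<close> and
        produces the damping factor. The total \<theta>/2 is the largest rate for which the moment
        bound applies.\<close>
      have "g (J \<omega>) \<le> \<bar>X \<omega>\<bar>\<^sup>2 * exp (\<theta> / 2 * \<bar>X \<omega>\<bar> - \<theta> * a / 4)"
        unfolding g_def
      proof (intro mult_mono power_mono)
        have "?c * J \<omega> \<le> \<theta> / 4 * \<bar>X \<omega>\<bar>"
          using elim assms(4,5) by (intro mult_mono) auto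
        moreover have "\<theta> * a \<le> \<theta> * \<bar>X \<omega>\<bar>"
          using False elim assms(4) by (intro mult_left_mono) auto
        ultimately have "?c * J \<omega> \<le> \<theta> / 2 * \<bar>X \<omega>\<bar> - \<theta> * a / 4" by (simp add: field_simps)
        then show "exp (?c * J \<omega>) \<le> exp (\<theta> / 2 * \<bar>X \<omega>\<bar> - \<theta> * a / 4)" by simp
      qed (use elim in auto)
      also have "\<dots> = h \<omega>"
        unfolding h_def diff_conv_add_uminus exp_add by (simp only: ac_simps)
      also have "\<dots> \<le> a * exp (?c * a) * J \<omega> + h \<omega>" using elim assms(6) by simp
      finally show ?thesis .
    qed
  qed
  have "(\<integral>\<omega>. exp (z * complex_of_real (J \<omega>)) \<partial>M) - (1 + z * expectation J)
    = (\<integral>\<omega>. ?f \<omega> - 1 - z * J \<omega> \<partial>M)"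
    using iF iJ by (simp add: prob_space)
  also have "cmod \<dots> \<le> (\<integral>\<omega>. cmod (?f \<omega> - 1 - z * J \<omega>) \<partial>M)"
    by (rule Bochner_Integration.integral_norm_bound)
  also have "\<dots> \<le> (\<integral>\<omega>. ?c\<^sup>2 * (a * exp (?c * a) * J \<omega> + h \<omega>) \<partial>M)"
  proof (rule integral_mono_AE)
    show "AE \<omega> in M. cmod (?f \<omega> - 1 - z * J \<omega>) \<le> ?c\<^sup>2 * (a * exp (?c * a) * J \<omega> + h \<omega>)"
      using gb J
    proof eventually_elim
      case (elim \<omega>)
      have "cmod (?f \<omega> - 1 - z * J \<omega>) \<le> ?c\<^sup>2 * g (J \<omega>)"
        using exp_minus_two_terms_bound[of "z * J \<omega>"] elim(2)
        by (simp add: norm_mult power_mult_distrib g_def algebra_simps)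
      also have "\<dots> \<le> ?c\<^sup>2 * (a * exp (?c * a) * J \<omega> + h \<omega>)"
        by (rule mult_left_mono[OF elim(1)]) simp
      finally show ?case .
    qed
  qed (use iF iJ ih in auto)
  also have "\<dots> = ?c\<^sup>2 * (a * exp (?c * a) * expectation J + expectation h)"
    using iJ ih by simp
  also have "\<dots> \<le> ?c\<^sup>2 * (a * exp (?c * a) * expectation J
         + 8 / \<theta>\<^sup>2 * exp (- (\<theta> * a / 4)) * expectation (\<lambda>\<omega>. exp (\<theta> * \<bar>X \<omega>\<bar>)))"
  proof (intro mult_left_mono add_left_mono)
    have "expectation h = exp (- (\<theta> * a / 4)) * (\<integral>\<omega>. \<bar>X \<omega>\<bar> ^ 2 * exp (\<theta> / 2 * \<bar>X \<omega>\<bar>) \<partial>M)"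
      unfolding h_def by simp
    also have "\<dots> \<le> exp (- (\<theta> * a / 4)) * (fact 2 * (2 / \<theta>) ^ 2 * expectation (\<lambda>\<omega>. exp (\<theta> * \<bar>X \<omega>\<bar>)))"
      using assms(4) by (intro mult_left_mono integrable_power_exp(2)[OF assms(1) int]) auto
    finally show "expectation h \<le> 8 / \<theta>\<^sup>2 * exp (- (\<theta> * a / 4)) * expectation (\<lambda>\<omega>. exp (\<theta> * \<bar>X \<omega>\<bar>))"
      by (simp add: power_divide ac_simps)
  qed simp
  finally show ?thesis .
qed

section \<open>Consequences of stationarity: exponential moments of the waiting time\<close>

lemma stationary_integral:
  fixes f :: "real \<Rightarrow> 'b::{banach, second_countable_topology}"
  assumes "random_variable borel W" "random_variable borel X"
    and st: "distr M borel W = distr M borel (\<lambda>\<omega>. max 0 (W \<omega> + X \<omega>))" and "f \<in> borel_measurable borel"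
  shows "(\<integral>\<omega>. f (max 0 (W \<omega> + X \<omega>)) \<partial>M) = (\<integral>\<omega>. f (W \<omega>) \<partial>M)"
    and "integrable M (\<lambda>\<omega>. f (max 0 (W \<omega> + X \<omega>))) \<longleftrightarrow> integrable M (\<lambda>\<omega>. f (W \<omega>))"
proof -
  note [measurable] = assms(1,2,4)
  show "(\<integral>\<omega>. f (max 0 (W \<omega> + X \<omega>)) \<partial>M) = (\<integral>\<omega>. f (W \<omega>) \<partial>M)"
    by (rule distr_eq_integral(1)[OF _ _ _ st, symmetric]) measurable
  show "integrable M (\<lambda>\<omega>. f (max 0 (W \<omega> + X \<omega>))) \<longleftrightarrow> integrable M (\<lambda>\<omega>. f (W \<omega>))"
    by (rule distr_eq_integral(2)[OF _ _ _ st, symmetric]) measurable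
qed

text \<open>
  With \<open>V = e^(s W)\<close> and \<open>l \<ge> E[e^(s X)]\<close>, the elementary bound
  \<open>min (v * e) K \<le> (if l * v \<le> K then v * e else K)\<close> replaces Jensen's inequality and turns
  stationarity into \<open>E[min V K - min (l * V) K] \<le> 1\<close>, uniformly in \<open>K\<close>.
\<close>
lemma stationary_exp_moment:
  fixes W X :: "'a \<Rightarrow> real"
  assumes ind: "indep_var borel W borel X"
    and st: "distr M borel W = distr M borel (\<lambda>\<omega>. max 0 (W \<omega> + X \<omega>))"
    and int: "integrable M (\<lambda>\<omega>. exp (s * X \<omega>))" and less: "expectation (\<lambda>\<omega>. exp (s * X \<omega>)) < 1"
    and "0 \<le> s"
  shows "integrable M (\<lambda>\<omega>. exp (s * W \<omega>))"
proof -
  have W[measurable]: "random_variable borel W" and X[measurable]: "random_variable borel X"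
    using ind indep_var_rv1 indep_var_rv2 by blast+
  \<comment> \<open>The floor 1/2 makes \<open>l\<close> positive at once, which the bound
    \<open>K / l\<close> for \<open>g\<close> uses, and leaves it below 1.\<close>
  define l where "l = max (1/2) (expectation (\<lambda>\<omega>. exp (s * X \<omega>)))"
  have l: "0 < l" "l < 1" using less by (auto simp: l_def)
  define V where "V \<omega> = exp (s * W \<omega>)" for \<omega>
  have [measurable]: "V \<in> borel_measurable M" unfolding V_def by measurable
  have V0: "V \<omega> > 0" for \<omega> by (simp add: V_def)
  have ib: "integrable M f" if "f \<in> borel_measurable M" "\<And>\<omega>. \<bar>f \<omega>\<bar> \<le> B" for f :: "'a \<Rightarrow> real" and B
    using that by (intro integrable_const_bound[where B=B]) auto
  \<comment> \<open>Finiteness of \<open>E[V]\<close> is the claim itself, so terms can be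
    subtracted only after truncation. The bound is free of \<open>K\<close>, hence it survives the
    monotone limit over \<open>K\<close>.\<close>
  have trunc: "(\<integral>\<omega>. (if V \<omega> \<le> K then V \<omega> else 0) \<partial>M) \<le> 1 / (1 - l)" if K: "K \<ge> 0" for K
  proof -
    \<comment> \<open>Truncating by a condition on \<open>W\<close> alone keeps the product with
      \<open>e^(s X)\<close> accessible to independence. The threshold involves \<open>l\<close> so
      that \<open>l * g + k\<close> below is exactly \<open>min (l * V) K\<close>.\<close>
    define g where "g w = (if l * exp (s * w) \<le> K then exp (s * w) else 0)" for w
    have [measurable]: "g \<in> borel_measurable borel" unfolding g_def by measurable
    have gle: "\<bar>g w\<bar> \<le> K / l" for w
      using l K by (auto simp: g_def field_simps)
    have ig: "integrable M (\<lambda>\<omega>. g (W \<omega>))" by (rule ib[of _ "K / l"]) (use gle in auto)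
    have iE: "integrable M (\<lambda>\<omega>. g (W \<omega>) * exp (s * X \<omega>))"
      by (intro indep_var_integrable indep_var_compose[OF ind, unfolded comp_def] int ig) auto
    have E: "(\<integral>\<omega>. g (W \<omega>) * exp (s * X \<omega>) \<partial>M) = (\<integral>\<omega>. g (W \<omega>) \<partial>M) * (\<integral>\<omega>. exp (s * X \<omega>) \<partial>M)"
      by (intro indep_var_lebesgue_integral indep_var_compose[OF ind, unfolded comp_def] int ig) auto
    have "(\<integral>\<omega>. g (W \<omega>) \<partial>M) \<ge> 0" by (intro Bochner_Integration.integral_nonneg) (auto simp: g_def)
    then have El: "(\<integral>\<omega>. g (W \<omega>) * exp (s * X \<omega>) \<partial>M) \<le> (\<integral>\<omega>. g (W \<omega>) \<partial>M) * l"
      unfolding E by (intro mult_left_mono) (auto simp: l_def)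
    define k where "k \<omega> = (if l * V \<omega> \<le> K then 0 else K)" for \<omega>
    have [measurable]: "k \<in> borel_measurable M" unfolding k_def by measurable
    have ik: "integrable M k" by (rule ib[of _ K]) (use K in \<open>auto simp: k_def\<close>)
    have im: "integrable M (\<lambda>\<omega>. min (c * V \<omega>) K)" if "c \<ge> 0" for c
    proof (rule ib[of _ K])
      show "\<bar>min (c * V \<omega>) K\<bar> \<le> K" for \<omega>
        using K mult_nonneg_nonneg[OF that less_imp_le[OF V0]] by (auto simp: min_def)
    qed simp
    have "(\<integral>\<omega>. min (V \<omega>) K \<partial>M) = (\<integral>\<omega>. min (exp (s * max 0 (W \<omega> + X \<omega>))) K \<partial>M)"
      unfolding V_def using stationary_integral(1)[OF W X st, of "\<lambda>w. min (exp (s * w)) K"] by simp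
    also have "\<dots> \<le> (\<integral>\<omega>. g (W \<omega>) * exp (s * X \<omega>) + k \<omega> + 1 \<partial>M)"
    proof (rule integral_mono)
      show "integrable M (\<lambda>\<omega>. min (exp (s * max 0 (W \<omega> + X \<omega>))) K)"
        by (rule ib[of _ K]) (use K in \<open>auto simp: min_def\<close>)
      show "min (exp (s * max 0 (W \<omega> + X \<omega>))) K \<le> g (W \<omega>) * exp (s * X \<omega>) + k \<omega> + 1" for \<omega>
      proof -
        \<comment> \<open>The summand 1 pays for the reflection at 0; it is the source of the 1 in
          the final bound.\<close>
        have "exp (s * max 0 (W \<omega> + X \<omega>)) \<le> exp (s * W \<omega>) * exp (s * X \<omega>) + 1"
          by (auto simp: max_def distrib_left exp_add)
        then show ?thesis using K by (auto simp: g_def k_def V_def)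
      qed
    qed (use iE ik in auto)
    also have "\<dots> = (\<integral>\<omega>. g (W \<omega>) * exp (s * X \<omega>) \<partial>M) + expectation k + 1"
      using iE ik by (simp add: prob_space)
    also have "\<dots> \<le> (\<integral>\<omega>. g (W \<omega>) \<partial>M) * l + expectation k + 1" using El by simp
    also have "\<dots> = (\<integral>\<omega>. l * g (W \<omega>) + k \<omega> \<partial>M) + 1" using ig ik by simp
    also have "(\<lambda>\<omega>. l * g (W \<omega>) + k \<omega>) = (\<lambda>\<omega>. min (l * V \<omega>) K)"
      by (auto simp: fun_eq_iff g_def k_def V_def)
    finally have "(\<integral>\<omega>. min (1 * V \<omega>) K - min (l * V \<omega>) K \<partial>M) \<le> 1"
      using im[of 1] im[of l] l by simp
    \<comment> \<open>Where \<open>V \<le> K\<close> neither minimum is cut off, so the difference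
      is \<open>(1 - l) * V\<close>; elsewhere it is nonnegative.\<close>
    moreover have "(\<integral>\<omega>. (1 - l) * (if V \<omega> \<le> K then V \<omega> else 0) \<partial>M)
        \<le> (\<integral>\<omega>. min (1 * V \<omega>) K - min (l * V \<omega>) K \<partial>M)"
    proof (rule integral_mono)
      show "integrable M (\<lambda>\<omega>. (1 - l) * (if V \<omega> \<le> K then V \<omega> else 0))"
        by (intro integrable_mult_right ib[of _ K]) (use K V0 in \<open>auto simp: less_imp_le\<close>)
      show "(1 - l) * (if V \<omega> \<le> K then V \<omega> else 0) \<le> min (1 * V \<omega>) K - min (l * V \<omega>) K" for \<omega>
      proof -
        have "l * V \<omega> \<le> V \<omega>" using l V0[of \<omega>] by (simp add: mult_le_cancel_right1)
        then show ?thesis by (auto simp: algebra_simps)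
      qed
    qed (use im[of 1] im[of l] l in auto)
    ultimately have "(1 - l) * (\<integral>\<omega>. (if V \<omega> \<le> K then V \<omega> else 0) \<partial>M) \<le> 1"
      unfolding integral_mult_right_zero by (rule order_trans[rotated])
    then show ?thesis using l by (simp add: field_simps)
  qed
  have lim: "(\<lambda>i::nat. (\<integral>\<^sup>+\<omega>. ennreal (if V \<omega> \<le> real i then V \<omega> else 0) \<partial>M)) \<longlonglongrightarrow> (\<integral>\<^sup>+\<omega>. ennreal (V \<omega>) \<partial>M)"
  proof (rule nn_integral_LIMSEQ)
    show "incseq (\<lambda>i \<omega>. ennreal (if V \<omega> \<le> real i then V \<omega> else 0))"
      by (auto simp: incseq_def le_fun_def V0 less_imp_le)
    show "(\<lambda>i. ennreal (if V \<omega> \<le> real i then V \<omega> else 0)) \<longlonglongrightarrow> ennreal (V \<omega>)" for \<omega>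
    proof (rule tendsto_eventually)
      show "\<forall>\<^sub>F i in sequentially. ennreal (if V \<omega> \<le> real i then V \<omega> else 0) = ennreal (V \<omega>)"
        using eventually_ge_at_top[of "nat \<lceil>V \<omega>\<rceil>"]
        by eventually_elim (auto simp: nat_ceiling_le_eq)
    qed
  qed auto
  have "(\<integral>\<^sup>+\<omega>. ennreal (if V \<omega> \<le> real i then V \<omega> else 0) \<partial>M) \<le> ennreal (1 / (1 - l))" for i :: nat
  proof -
    have "integrable M (\<lambda>\<omega>. if V \<omega> \<le> real i then V \<omega> else 0)"
      by (rule ib[of _ "real i"]) (use V0 in \<open>auto simp: less_imp_le\<close>)
    then have "(\<integral>\<^sup>+\<omega>. ennreal (if V \<omega> \<le> real i then V \<omega> else 0) \<partial>M)
       = ennreal (\<integral>\<omega>. (if V \<omega> \<le> real i then V \<omega> else 0) \<partial>M)"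
      by (intro nn_integral_eq_integral) (use V0 in \<open>auto simp: less_imp_le\<close>)
    then show ?thesis using trunc[of "real i"] by (simp add: ennreal_leI)
  qed
  then have "(\<integral>\<^sup>+\<omega>. ennreal (V \<omega>) \<partial>M) \<le> ennreal (1 / (1 - l))"
    by (intro LIMSEQ_le_const2[OF lim]) auto
  then have "(\<integral>\<^sup>+\<omega>. ennreal (V \<omega>) \<partial>M) < \<infinity>"
    by (rule le_less_trans) simp
  then have "integrable M V"
    by (intro integrableI_nonneg) (auto simp: V0 less_imp_le)
  then show ?thesis by (simp add: V_def[abs_def])
qed

section \<open>The quantitative transform estimate for one stationary queue\<close>

text \<open>Here \<open>r\<close> stands for \<surd>n, and the error constant involves only
  \<open>T\<close>, \<open>B\<close>, \<open>C\<close>, \<open>b\<close> and \<theta>, which can be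
  chosen independently of \<open>n\<close>. The second-moment hypothesis says that \<gamma> is the
  variance of \<open>X\<close> divided by 2\<epsilon>. The bounds on \<epsilon> express that it is
  of order \<open>1 / r^2\<close>, and \<open>1 \<le> ln r\<close> lets constants be absorbed into
  the logarithm.\<close>

lemma queue_transform_bound:
  fixes W X :: "'a \<Rightarrow> real" and \<epsilon> \<gamma> r \<theta> C T B b :: real and t :: complex
  assumes ind: "indep_var borel W borel X"
    and st: "distr M borel W = distr M borel (\<lambda>\<omega>. max 0 (W \<omega> + X \<omega>))"
    and W0: "AE \<omega> in M. 0 \<le> W \<omega>"
    and EX: "expectation X = - \<epsilon>" and EX2: "expectation (\<lambda>\<omega>. (X \<omega>)\<^sup>2) = 2 * \<epsilon> * \<gamma> + \<epsilon>\<^sup>2"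
    and int: "integrable M (\<lambda>\<omega>. exp (\<theta> * r * \<bar>X \<omega>\<bar>))"
    and C: "expectation (\<lambda>\<omega>. exp (\<theta> * r * \<bar>X \<omega>\<bar>)) \<le> C"
    and pos: "0 < \<epsilon>" "0 < \<gamma>" "0 < \<theta>" "1 \<le> ln r" "0 < b" "0 < r"
    and \<epsilon>: "b \<le> \<epsilon> * r\<^sup>2" "\<epsilon> * r \<le> B"
    and T: "1 / (4 * \<gamma>) \<le> T" "4 * T \<le> \<theta> * r"
    and r: "4 * (T * B / 2 + 24 * T\<^sup>2 * C / (\<theta> ^ 3 * b)) \<le> r"
    and t: "cmod t \<le> T" "- 1 / (4 * \<gamma>) \<le> Re t"
  shows "integrable M (\<lambda>\<omega>. exp (- t * complex_of_real (W \<omega>)))"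
    and "cmod ((\<integral>\<omega>. exp (- t * complex_of_real (W \<omega>)) \<partial>M) - inverse (1 + complex_of_real \<gamma> * t))
      \<le> (2 * (T * (4 * exp (4 * T / \<theta>) / \<theta> + 8 * C / (\<theta>\<^sup>2 * b)))
          + 3 * (T * B / 2 + 24 * T\<^sup>2 * C / (\<theta> ^ 3 * b))) * ln r / r"
proof -
  have W[measurable]: "random_variable borel W" and X[measurable]: "random_variable borel X"
    using ind indep_var_rv1 indep_var_rv2 by blast+
  have r0: "0 < r" "1 \<le> r" using pos ln_ge_zero_iff[of r] by (simp_all del: ln_ge_zero_iff)
  have "0 < 1 / (4 * \<gamma>)" using pos by simp
  then have T0: "0 < T" using T(1) by linarith
  have C0: "0 \<le> C" using C by (rule order_trans[rotated]) (intro Bochner_Integration.integral_nonneg; simp)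
  \<comment> \<open>\<open>K2\<close> is the relative error constant for the transform of
    \<open>X\<close>: the first summand comes from the \<epsilon>^2 in the second moment, the second
    from the Taylor remainder. \<open>K1\<close> does the same for the idle time, with one summand
    for each side of the splitting level.\<close>
  define K2 where "K2 = T * B / 2 + 24 * T\<^sup>2 * C / (\<theta> ^ 3 * b)"
  define K1 where "K1 = T * (4 * exp (4 * T / \<theta>) / \<theta> + 8 * C / (\<theta>\<^sup>2 * b))"
  have B0: "0 \<le> B" using \<epsilon>(2) pos(1) r0 by (auto intro: order_trans[rotated])
  have K20: "0 \<le> K2" unfolding K2_def using T0 B0 C0 pos by simp
  have K10: "0 \<le> K1" unfolding K1_def using T0 C0 pos by simp
  have K2r: "K2 / r \<le> 1 / 4" using r r0 by (simp add: K2_def field_simps)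
  define \<psi> where "\<psi> t = (\<integral>\<omega>. exp (- t * complex_of_real (X \<omega>)) \<partial>M)" for t
  have \<psi>: "cmod (\<psi> u - (1 + \<epsilon> * u + \<epsilon> * \<gamma> * u\<^sup>2)) \<le> \<epsilon> * cmod u * (K2 / r)" if u: "cmod u \<le> T" for u :: complex
  proof -
    have "cmod (\<psi> u - (1 + - u * expectation X + (- u)\<^sup>2 / 2 * expectation (\<lambda>\<omega>. (X \<omega>)\<^sup>2)))
      \<le> 24 / (\<theta> * r) ^ 3 * cmod (- u) ^ 3 * expectation (\<lambda>\<omega>. exp (\<theta> * r * \<bar>X \<omega>\<bar>))"
      unfolding \<psi>_def using u T T0 pos r0 by (intro transform_expansion int) auto
    also have "\<dots> \<le> 24 / (\<theta> * r) ^ 3 * cmod u ^ 3 * C"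
      using C pos r0 by (intro mult_mono) auto
    \<comment> \<open>The error is needed relative to \<epsilon>\<bar>u\<bar>. Extracting \<epsilon>
      costs a factor \<open>1 / \<epsilon>\<close>, at most \<open>r^2 / b\<close>, so
      \<open>1 / r\<close> remains of the cubic rate \<open>1 / r^3\<close>.\<close>
    also have "\<dots> = \<epsilon> * cmod u * (24 * (cmod u)\<^sup>2 * C / (\<theta> ^ 3 * (\<epsilon> * r\<^sup>2)) / r)"
      using pos r0 by (simp add: field_simps power2_eq_square power3_eq_cube)
    also have "\<dots> \<le> \<epsilon> * cmod u * (24 * T\<^sup>2 * C / (\<theta> ^ 3 * b) / r)"
      using pos r0 \<epsilon> T0 C0 u
      by (intro mult_left_mono divide_right_mono frac_le mult_right_mono power_mono) auto
    finally have 1: "cmod (\<psi> u - (1 + \<epsilon> * u + u\<^sup>2 / 2 * (2 * \<epsilon> * \<gamma> + \<epsilon>\<^sup>2)))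
        \<le> \<epsilon> * cmod u * (24 * T\<^sup>2 * C / (\<theta> ^ 3 * b) / r)"
      by (simp add: EX EX2 mult.commute)
    have "cmod (complex_of_real (\<epsilon>\<^sup>2 / 2) * u\<^sup>2) = \<epsilon> * cmod u * (cmod u * \<epsilon> / 2)"
      using pos by (simp add: norm_mult norm_power power2_eq_square)
    also have "\<dots> \<le> \<epsilon> * cmod u * (T * (B / r) / 2)"
      using pos u \<epsilon> r0 T0 by (intro mult_left_mono divide_right_mono mult_mono) (auto simp: field_simps)
    finally have 2: "cmod (complex_of_real (\<epsilon>\<^sup>2 / 2) * u\<^sup>2) \<le> \<epsilon> * cmod u * (T * (B / r) / 2)" .
    have "cmod (\<psi> u - (1 + \<epsilon> * u + \<epsilon> * \<gamma> * u\<^sup>2))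
       = cmod ((\<psi> u - (1 + \<epsilon> * u + u\<^sup>2 / 2 * (2 * \<epsilon> * \<gamma> + \<epsilon>\<^sup>2))) + complex_of_real (\<epsilon>\<^sup>2 / 2) * u\<^sup>2)"
      by (rule arg_cong[where f=cmod]) (simp add: field_simps)
    also have "\<dots> \<le> \<epsilon> * cmod u * (24 * T\<^sup>2 * C / (\<theta> ^ 3 * b) / r) + \<epsilon> * cmod u * (T * (B / r) / 2)"
      using 1 2 by (rule norm_triangle_mono)
    also have "\<dots> = \<epsilon> * cmod u * (K2 / r)"
      using pos by (simp add: K2_def field_simps)
    finally show ?thesis .
  qed
  \<comment> \<open>This is the distance from 0 to the left edge of the admissible half-plane. At
    \<open>u = - s\<close> the main term is \<open>1 - 3/4 * \<epsilon> * s\<close> and the error at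
    most \<open>\<epsilon> * s / 4\<close>, so the exponential moment of \<open>X\<close> at
    \<open>s\<close> lies below 1.\<close>
  define s where "s = 1 / (4 * \<gamma>)"
  have s: "0 < s" "s \<le> T" "\<gamma> * s = 1 / 4" using pos T(1) by (auto simp: s_def)
  have iX: "integrable M (\<lambda>\<omega>. exp (u * complex_of_real (X \<omega>)))" if "cmod u \<le> T" for u :: complex
    using that T T0 by (intro integrable_exp_complex[OF _ _ int]) auto
  have expX: "integrable M (\<lambda>\<omega>. exp (s * X \<omega>))"
    using integrable_norm[OF iX[of s]] s by (simp add: norm_exp_eq_Re)
  have "expectation (\<lambda>\<omega>. exp (s * X \<omega>)) < 1"
  proof -
    have "\<psi> (- complex_of_real s) = (\<integral>\<omega>. complex_of_real (exp (s * X \<omega>)) \<partial>M)"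
      unfolding \<psi>_def by (simp flip: exp_of_real)
    also have "\<dots> = complex_of_real (expectation (\<lambda>\<omega>. exp (s * X \<omega>)))"
      by simp
    finally have "\<psi> (- complex_of_real s) - (1 + \<epsilon> * (- complex_of_real s) + \<epsilon> * \<gamma> * (- complex_of_real s)\<^sup>2)
      = complex_of_real (expectation (\<lambda>\<omega>. exp (s * X \<omega>)) - (1 - \<epsilon> * s + \<epsilon> * \<gamma> * s\<^sup>2))"
      by simp
    moreover have "cmod (\<psi> (- complex_of_real s) - (1 + \<epsilon> * (- complex_of_real s) + \<epsilon> * \<gamma> * (- complex_of_real s)\<^sup>2))
       \<le> \<epsilon> * s * (K2 / r)"
      using \<psi>[of "- complex_of_real s"] s by simp
    ultimately have "\<bar>expectation (\<lambda>\<omega>. exp (s * X \<omega>)) - (1 - \<epsilon> * s + \<epsilon> * \<gamma> * s\<^sup>2)\<bar> \<le> \<epsilon> * s * (K2 / r)"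
      by (simp only: norm_of_real)
    also have "\<dots> \<le> \<epsilon> * s * (1 / 4)"
      using K2r pos s by (intro mult_left_mono) auto
    finally have "\<bar>expectation (\<lambda>\<omega>. exp (s * X \<omega>)) - (1 - \<epsilon> * s + \<epsilon> * \<gamma> * s\<^sup>2)\<bar> \<le> \<epsilon> * s * (1 / 4)" .
    moreover have "\<epsilon> * \<gamma> * s\<^sup>2 = \<epsilon> * s * (1 / 4)"
      using s(3) by (simp add: power2_eq_square)
    moreover have "0 < \<epsilon> * s" using pos s by simp
    ultimately show ?thesis by linarith
  qed
  then have expW: "integrable M (\<lambda>\<omega>. exp (s * W \<omega>))"
    using stationary_exp_moment[OF ind st expX] s by simp
  have iexpW: "integrable M (\<lambda>\<omega>. exp (- u * complex_of_real (W \<omega>)))" if "- s \<le> Re u" for u :: complex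
  proof (rule Bochner_Integration.integrable_bound[OF expW])
    show "AE \<omega> in M. norm (exp (- u * complex_of_real (W \<omega>))) \<le> norm (exp (s * W \<omega>))"
      using W0
    proof eventually_elim
      case (elim \<omega>)
      have "- Re u * W \<omega> \<le> s * W \<omega>" using elim that by (intro mult_right_mono) auto
      then show ?case by (simp add: norm_exp_eq_Re)
    qed
  qed simp
  have ret: "- s \<le> Re t" using t by (simp add: s_def)
  then show iW: "integrable M (\<lambda>\<omega>. exp (- t * complex_of_real (W \<omega>)))" by (rule iexpW)
  \<comment> \<open>A finite mean is needed so that \<open>E[W]\<close> cancels in the computation
    of \<open>E[J]\<close>.\<close>
  have "integrable M W"
  proof (rule Bochner_Integration.integrable_bound)
    show "integrable M (\<lambda>\<omega>. 1 / s * exp (s * W \<omega>))" using expW by simp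
    show "AE \<omega> in M. norm (W \<omega>) \<le> norm (1 / s * exp (s * W \<omega>))"
      using W0
    proof eventually_elim
      case (elim \<omega>)
      have "s * W \<omega> \<le> exp (s * W \<omega>)" using exp_ge_add_one_self[of "s * W \<omega>"] by linarith
      then show ?case using s elim by (simp add: field_simps)
    qed
  qed simp
  define J where "J \<omega> = max 0 (- (W \<omega> + X \<omega>))" for \<omega>
  have [measurable]: "J \<in> borel_measurable M" unfolding J_def by measurable
  have JX: "AE \<omega> in M. 0 \<le> J \<omega> \<and> J \<omega> \<le> \<bar>X \<omega>\<bar>"
    using W0 by eventually_elim (auto simp: J_def)
  have intX: "integrable M X"
  proof -
    have "integrable M (\<lambda>\<omega>. \<bar>X \<omega>\<bar>)"
      using integrable_power_exp(1)[OF X int, of 0 1] pos r0 by simp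
    then show ?thesis by (rule Bochner_Integration.integrable_bound) auto
  qed
  have EJ: "expectation J = \<epsilon>"
  proof -
    have i: "integrable M (\<lambda>\<omega>. max 0 (W \<omega> + X \<omega>))"
      using stationary_integral(2)[OF W X st, of "\<lambda>x. x"] \<open>integrable M W\<close> by simp
    have "expectation J = (\<integral>\<omega>. max 0 (W \<omega> + X \<omega>) - (W \<omega> + X \<omega>) \<partial>M)"
      by (intro Bochner_Integration.integral_cong) (auto simp: J_def)
    also have "\<dots> = expectation W - (expectation W + expectation X)"
      using i \<open>integrable M W\<close> intX stationary_integral(1)[OF W X st, of "\<lambda>x. x"] by simp
    finally show ?thesis by (simp add: EX)
  qed
  define \<phi> where "\<phi> = (\<integral>\<omega>. exp (- t * complex_of_real (W \<omega>)) \<partial>M)"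
  define \<eta> where "\<eta> = (\<integral>\<omega>. exp (t * complex_of_real (J \<omega>)) \<partial>M)"
  \<comment> \<open>For \<open>y = W + X\<close>, one of the positive and negative parts vanishes,
    so \<open>e^(- t y) = e^(- t y^+) + e^(t y^-) - 1\<close>. Independence factors the left side,
    and stationarity identifies the first term on the right with \<phi>.\<close>
  have id: "\<phi> * (1 - \<psi> t) = 1 - \<eta>"
  proof -
    have iJ: "integrable M (\<lambda>\<omega>. exp (t * complex_of_real (J \<omega>)))"
      using JX t T T0 by (intro integrable_exp_complex[OF _ _ int]) auto
    have iX': "integrable M (\<lambda>\<omega>. exp (- t * complex_of_real (X \<omega>)))"
      using iX[of "- t"] t by simp
    have indE: "indep_var borel (\<lambda>\<omega>. exp (- t * complex_of_real (W \<omega>))) borel (\<lambda>\<omega>. exp (- t * complex_of_real (X \<omega>)))"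
      by (intro indep_var_compose[OF ind, unfolded comp_def]) auto
    have iM: "integrable M (\<lambda>\<omega>. exp (- t * complex_of_real (max 0 (W \<omega> + X \<omega>))))"
      using stationary_integral(2)[OF W X st, of "\<lambda>w. exp (- t * complex_of_real w)"] iW by simp
    have "\<phi> * \<psi> t = (\<integral>\<omega>. exp (- t * complex_of_real (W \<omega>)) * exp (- t * complex_of_real (X \<omega>)) \<partial>M)"
      unfolding \<phi>_def \<psi>_def by (rule indep_var_lebesgue_integral[symmetric, OF indE iW iX'])
    also have "\<dots> = (\<integral>\<omega>. exp (- t * complex_of_real (max 0 (W \<omega> + X \<omega>))) + exp (t * complex_of_real (J \<omega>)) - 1 \<partial>M)"
    proof (intro Bochner_Integration.integral_cong refl)
      fix \<omega>
      define y where "y = W \<omega> + X \<omega>"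
      have "exp (- t * complex_of_real (W \<omega>)) * exp (- t * complex_of_real (X \<omega>)) = exp (- t * complex_of_real y)"
        by (simp add: y_def algebra_simps flip: exp_add)
      also have "\<dots> = exp (- t * complex_of_real (max 0 y)) + exp (t * complex_of_real (max 0 (- y))) - 1"
        by (cases "0 \<le> y") (auto simp: max_def)
      finally show "exp (- t * complex_of_real (W \<omega>)) * exp (- t * complex_of_real (X \<omega>))
          = exp (- t * complex_of_real (max 0 (W \<omega> + X \<omega>))) + exp (t * complex_of_real (J \<omega>)) - 1"
        by (simp only: J_def y_def)
    qed
    also have "\<dots> = \<phi> + \<eta> - 1"
      using iM iJ stationary_integral(1)[OF W X st, of "\<lambda>w. exp (- t * complex_of_real w)"]
      by (simp add: prob_space \<phi>_def \<eta>_def)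
    finally show ?thesis by (simp add: algebra_simps)
  qed
  \<comment> \<open>This level makes the damping factor
    \<open>exp (- (\<theta> * r * a / 4))\<close> equal to \<open>1 / r\<close>. The part below
    \<open>a\<close> then has relative order \<open>ln r / r\<close>, which is where the logarithm
    in the rate comes from.\<close>
  define a where "a = 4 * ln r / (\<theta> * r)"
  have a0: "0 \<le> a" using pos r0 by (simp add: a_def)
  have \<eta>: "cmod (\<eta> - (1 + t * \<epsilon>)) \<le> \<epsilon> * cmod t * (K1 * ln r / r)"
  proof -
    have lr: "ln r \<le> r" using ln_bound r0 by auto
    have Ta: "cmod t * a \<le> 4 * T / \<theta>"
    proof -
      have "cmod t * a \<le> T * (4 * r / (\<theta> * r))"
        unfolding a_def using t T0 lr pos r0 by (intro mult_mono divide_right_mono) auto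
      then show ?thesis using r0 by (simp add: mult.commute)
    qed
    have ea: "exp (- (\<theta> * r * a / 4)) = 1 / r"
      using pos r0 by (simp add: a_def exp_minus inverse_eq_divide)
    have "cmod (\<eta> - (1 + t * expectation J))
      \<le> (cmod t)\<^sup>2 * (a * exp (cmod t * a) * expectation J
         + 8 / (\<theta> * r)\<^sup>2 * exp (- (\<theta> * r * a / 4)) * expectation (\<lambda>\<omega>. exp (\<theta> * r * \<bar>X \<omega>\<bar>)))"
      unfolding \<eta>_def using pos r0 t T a0 JX by (intro idle_transform_expansion int) auto
    also have "\<dots> \<le> (cmod t)\<^sup>2 * (a * exp (4 * T / \<theta>) * \<epsilon> + 8 / (\<theta> * r)\<^sup>2 * (1 / r) * C)"
      unfolding EJ ea using C Ta a0 pos r0 by (intro mult_left_mono add_mono mult_mono) auto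
    also have "\<dots> = \<epsilon> * cmod t * (cmod t * (4 * exp (4 * T / \<theta>) / \<theta> * ln r + 8 * C / (\<theta>\<^sup>2 * (\<epsilon> * r\<^sup>2)) * 1) / r)"
      using pos r0 by (simp add: a_def field_simps power2_eq_square)
    also have "\<dots> \<le> \<epsilon> * cmod t * (T * (4 * exp (4 * T / \<theta>) / \<theta> * ln r + 8 * C / (\<theta>\<^sup>2 * b) * ln r) / r)"
      using pos r0 t T0 C0 \<epsilon>
      by (intro mult_left_mono divide_right_mono mult_mono add_mono divide_left_mono) auto
    also have "\<dots> = \<epsilon> * cmod t * (K1 * ln r / r)"
      by (simp add: K1_def algebra_simps)
    finally show ?thesis by (simp add: EJ)
  qed
  have goal: "cmod (\<phi> - inverse (1 + \<gamma> * t)) \<le> (2 * K1 + 3 * K2) * ln r / r"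
  proof (cases "t = 0")
    case True
    have "\<phi> = 1" by (simp add: \<phi>_def True prob_space)
    then show ?thesis using K10 K20 pos r0 by (simp add: True)
  next
    case False
    have et: "complex_of_real \<epsilon> * t \<noteq> 0" "0 < \<epsilon> * cmod t" using False pos by auto
    \<comment> \<open>\<open>P\<close> and \<open>Q\<close> are the relative errors of the two
      expansions. After cancelling \<open>- (\<epsilon> * t)\<close> the identity reads
      \<open>\<phi> * (y + P) = 1 + Q\<close>.\<close>
    define P where "P = (\<psi> t - (1 + \<epsilon> * t + \<epsilon> * \<gamma> * t\<^sup>2)) / (\<epsilon> * t)"
    define Q where "Q = (\<eta> - (1 + t * \<epsilon>)) / (\<epsilon> * t)"
    define y where "y = 1 + \<gamma> * t"
    have "cmod P = cmod (\<psi> t - (1 + \<epsilon> * t + \<epsilon> * \<gamma> * t\<^sup>2)) / (\<epsilon> * cmod t)"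
      using pos by (simp add: P_def norm_divide norm_mult)
    then have Pn: "cmod P \<le> K2 / r"
      using \<psi>[OF t(1)] et(2) by (simp only: pos_divide_le_eq) (simp add: mult.commute)
    have "cmod Q = cmod (\<eta> - (1 + t * \<epsilon>)) / (\<epsilon> * cmod t)"
      using pos by (simp add: Q_def norm_divide norm_mult)
    then have Qn: "cmod Q \<le> K1 * ln r / r"
      using \<eta> et(2) by (simp only: pos_divide_le_eq) (simp add: mult.commute)
    have 1: "1 - \<psi> t = - (\<epsilon> * t) * (y + P)"
      using et(1) False pos by (simp add: P_def y_def field_simps power2_eq_square)
    have 2: "1 - \<eta> = - (\<epsilon> * t) * (1 + Q)"
      using et(1) False pos by (simp add: Q_def field_simps)
    have "- (\<epsilon> * t) * (\<phi> * (y + P)) = - (\<epsilon> * t) * (1 + Q)"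
      using id unfolding 1 2 by (simp only: ac_simps)
    then have eq: "\<phi> * (y + P) = 1 + Q"
      using et(1) by (simp only: mult_cancel_left) simp
    have "\<gamma> * (- s) \<le> \<gamma> * Re t" using ret pos by (intro mult_left_mono) auto
    then have "3 / 4 \<le> Re y" using s(3) by (simp add: y_def)
    then have y: "3 / 4 \<le> cmod y" using complex_Re_le_cmod[of y] by linarith
    have "cmod y \<le> cmod (y + P) + cmod P"
      using norm_triangle_ineq4[of "y + P" P] by simp
    then have yP: "1 / 2 \<le> cmod (y + P)" using y Pn K2r by linarith
    have n0: "y \<noteq> 0" "y + P \<noteq> 0" using y yP by auto
    have \<phi>: "\<phi> = (1 + Q) / (y + P)" using eq n0 by (simp add: eq_divide_eq)
    have diff: "(1 + Q) / z - inverse y = Q / z - (z - y) / (y * z)" if "z \<noteq> 0" for z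
      using that n0(1) by (simp add: field_simps)
    have "\<phi> - inverse y = Q / (y + P) - P / (y * (y + P))"
      unfolding \<phi> using diff[OF n0(2)] by simp
    also have "cmod \<dots> \<le> cmod Q / cmod (y + P) + cmod P / (cmod y * cmod (y + P))"
      by (rule order_trans[OF norm_triangle_ineq4]) (simp add: norm_divide norm_mult)
    \<comment> \<open>The bounds \<open>3/4 \<le> \<bar>y\<bar>\<close> and
      \<open>1/2 \<le> \<bar>y + P\<bar>\<close> give the factors 2 and 8/3; the latter is rounded
      up to 3.\<close>
    also have "\<dots> \<le> (K1 * ln r / r) / (1 / 2) + (K2 / r) / (3 / 4 * (1 / 2))"
      using y yP Pn Qn K10 K20 pos r0 by (intro add_mono frac_le mult_mono) auto
    also have "\<dots> \<le> 2 * (K1 * ln r / r) + 3 * (K2 * ln r / r)"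
    proof -
      have "K2 / r \<le> K2 * ln r / r" using pos r0 K20 by (simp add: divide_right_mono mult_le_cancel_left1)
      moreover have "0 \<le> K2 / r" using K20 r0 by simp
      ultimately show ?thesis by simp
    qed
    also have "\<dots> = (2 * K1 + 3 * K2) * ln r / r" by (simp add: add_divide_distrib algebra_simps)
    finally show ?thesis by (simp add: y_def)
  qed
  then show "cmod ((\<integral>\<omega>. exp (- t * complex_of_real (W \<omega>)) \<partial>M) - inverse (1 + complex_of_real \<gamma> * t))
      \<le> (2 * (T * (4 * exp (4 * T / \<theta>) / \<theta> + 8 * C / (\<theta>\<^sup>2 * b)))
          + 3 * (T * B / 2 + 24 * T\<^sup>2 * C / (\<theta> ^ 3 * b))) * ln r / r"
    unfolding \<phi>_def K1_def K2_def .
qed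

section \<open>Moments of weighted sums of independent centred variables\<close>

text \<open>The linear term of the expansion vanishes by centring, and
  \<open>1 + x \<le> exp x\<close> puts the quadratic term into the exponent. In this form the
  bounds multiply over independent summands, with only the sum of the squared coefficients
  left.\<close>

lemma centered_mgf_bound:
  fixes Z :: "'a \<Rightarrow> real"
  assumes Z[measurable]: "random_variable borel Z"
    and int: "integrable M (\<lambda>\<omega>. exp (\<delta> * \<bar>Z \<omega>\<bar>))" and "0 < \<delta>" "\<bar>c\<bar> \<le> \<delta> / 2"
    and EZ: "expectation Z = 0"
  shows "integrable M (\<lambda>\<omega>. exp (c * Z \<omega>))"
    and "expectation (\<lambda>\<omega>. exp (c * Z \<omega>)) \<le> exp (8 / \<delta>\<^sup>2 * expectation (\<lambda>\<omega>. exp (\<delta> * \<bar>Z \<omega>\<bar>)) * c\<^sup>2)"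
proof -
  show i: "integrable M (\<lambda>\<omega>. exp (c * Z \<omega>))"
  proof (rule Bochner_Integration.integrable_bound[OF int])
    have "c * Z \<omega> \<le> \<delta> * \<bar>Z \<omega>\<bar>" for \<omega>
    proof -
      have "c * Z \<omega> \<le> \<bar>c\<bar> * \<bar>Z \<omega>\<bar>" by (simp flip: abs_mult)
      also have "\<dots> \<le> \<delta> * \<bar>Z \<omega>\<bar>" using assms by (intro mult_right_mono) auto
      finally show ?thesis .
    qed
    then show "AE \<omega> in M. norm (exp (c * Z \<omega>)) \<le> norm (exp (\<delta> * \<bar>Z \<omega>\<bar>))" by simp
  qed simp
  have "integrable M (\<lambda>\<omega>. \<bar>Z \<omega>\<bar>)"
    using integrable_power_exp(1)[OF Z int, of 0 1] assms(3) by simp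
  then have iZ: "integrable M Z"
    by (rule Bochner_Integration.integrable_bound) auto
  let ?g = "\<lambda>\<omega>. \<bar>Z \<omega>\<bar> ^ 2 * exp (\<bar>c\<bar> * \<bar>Z \<omega>\<bar>)"
  have ig: "integrable M ?g"
    by (rule integrable_power_exp(1)[OF Z int]) (use assms in auto)
  have g: "expectation ?g \<le> fact 2 * (2 / \<delta>) ^ 2 * expectation (\<lambda>\<omega>. exp (\<delta> * \<bar>Z \<omega>\<bar>))"
    by (rule integrable_power_exp(2)[OF Z int]) (use assms in auto)
  have "expectation (\<lambda>\<omega>. exp (c * Z \<omega>)) \<le> expectation (\<lambda>\<omega>. 1 + c * Z \<omega> + c\<^sup>2 * ?g \<omega>)"
  proof (rule integral_mono)
    show "exp (c * Z \<omega>) \<le> 1 + c * Z \<omega> + c\<^sup>2 * ?g \<omega>" for \<omega>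
      using exp_minus_two_terms_bound[of "c * Z \<omega>"]
      by (simp add: abs_mult power_mult_distrib abs_le_iff algebra_simps)
  qed (use i iZ ig in auto)
  also have "\<dots> = 1 + c\<^sup>2 * expectation ?g"
    using iZ ig by (simp add: prob_space EZ)
  also have "\<dots> \<le> 1 + c\<^sup>2 * (fact 2 * (2 / \<delta>) ^ 2 * expectation (\<lambda>\<omega>. exp (\<delta> * \<bar>Z \<omega>\<bar>)))"
    using g by (intro add_left_mono mult_left_mono) auto
  also have "\<dots> = 1 + 8 / \<delta>\<^sup>2 * expectation (\<lambda>\<omega>. exp (\<delta> * \<bar>Z \<omega>\<bar>)) * c\<^sup>2"
    by (simp add: power_divide)
  also have "\<dots> \<le> exp (8 / \<delta>\<^sup>2 * expectation (\<lambda>\<omega>. exp (\<delta> * \<bar>Z \<omega>\<bar>)) * c\<^sup>2)"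
    by (rule exp_ge_add_one_self)
  finally show "expectation (\<lambda>\<omega>. exp (c * Z \<omega>))
      \<le> exp (8 / \<delta>\<^sup>2 * expectation (\<lambda>\<omega>. exp (\<delta> * \<bar>Z \<omega>\<bar>)) * c\<^sup>2)" .
qed

lemma indep_sum_mgf_bound:
  fixes Z :: "'i \<Rightarrow> 'a \<Rightarrow> real"
  assumes I: "finite I" and ind: "indep_vars (\<lambda>_. borel) Z I" and "0 < \<delta>"
    and int: "\<And>i. i \<in> I \<Longrightarrow> integrable M (\<lambda>\<omega>. exp (\<delta> * \<bar>Z i \<omega>\<bar>))"
    and D: "\<And>i. i \<in> I \<Longrightarrow> expectation (\<lambda>\<omega>. exp (\<delta> * \<bar>Z i \<omega>\<bar>)) \<le> D"
    and EZ: "\<And>i. i \<in> I \<Longrightarrow> expectation (Z i) = 0"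
    and c: "\<And>i. i \<in> I \<Longrightarrow> \<bar>c i\<bar> \<le> \<delta> / 2"
  shows "integrable M (\<lambda>\<omega>. exp (\<Sum>i\<in>I. c i * Z i \<omega>))"
    and "expectation (\<lambda>\<omega>. exp (\<Sum>i\<in>I. c i * Z i \<omega>)) \<le> exp (8 / \<delta>\<^sup>2 * D * (\<Sum>i\<in>I. (c i)\<^sup>2))"
proof -
  have Z: "random_variable borel (Z i)" if "i \<in> I" for i
    using ind that by (auto simp: indep_vars_def)
  have ind': "indep_vars (\<lambda>_. borel) (\<lambda>i \<omega>. exp (c i * Z i \<omega>)) I"
    by (rule indep_vars_compose2[OF ind]) auto
  have i: "integrable M (\<lambda>\<omega>. exp (c i * Z i \<omega>))" if "i \<in> I" for i
    using that assms by (intro centered_mgf_bound(1)[OF Z]) auto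
  show "integrable M (\<lambda>\<omega>. exp (\<Sum>i\<in>I. c i * Z i \<omega>))"
    using indep_vars_integrable[OF I ind' i] by (simp add: exp_sum I)
  have "expectation (\<lambda>\<omega>. exp (\<Sum>i\<in>I. c i * Z i \<omega>)) = (\<Prod>i\<in>I. expectation (\<lambda>\<omega>. exp (c i * Z i \<omega>)))"
    using indep_vars_lebesgue_integral[OF I ind' i] by (simp add: exp_sum I)
  also have "\<dots> \<le> (\<Prod>i\<in>I. exp (8 / \<delta>\<^sup>2 * D * (c i)\<^sup>2))"
  proof (rule prod_mono, intro conjI)
    fix i assume i: "i \<in> I"
    show "0 \<le> expectation (\<lambda>\<omega>. exp (c i * Z i \<omega>))"
      by (intro Bochner_Integration.integral_nonneg) auto
    have "expectation (\<lambda>\<omega>. exp (c i * Z i \<omega>))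
        \<le> exp (8 / \<delta>\<^sup>2 * expectation (\<lambda>\<omega>. exp (\<delta> * \<bar>Z i \<omega>\<bar>)) * (c i)\<^sup>2)"
      using i assms by (intro centered_mgf_bound(2)[OF Z]) auto
    also have "\<dots> \<le> exp (8 / \<delta>\<^sup>2 * D * (c i)\<^sup>2)"
      unfolding exp_le_cancel_iff using D[OF i] by (intro mult_right_mono mult_left_mono) auto
    finally show "expectation (\<lambda>\<omega>. exp (c i * Z i \<omega>)) \<le> exp (8 / \<delta>\<^sup>2 * D * (c i)\<^sup>2)" .
  qed
  also have "\<dots> = exp (8 / \<delta>\<^sup>2 * D * (\<Sum>i\<in>I. (c i)\<^sup>2))"
    by (simp add: exp_sum I sum_distrib_left)
  finally show "expectation (\<lambda>\<omega>. exp (\<Sum>i\<in>I. c i * Z i \<omega>)) \<le> exp (8 / \<delta>\<^sup>2 * D * (\<Sum>i\<in>I. (c i)\<^sup>2))" .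
qed

text \<open>From \<open>exp \<bar>S\<bar> \<le> exp S + exp (- S)\<close> and the one-sided bound
  for the coefficients \<open>c i\<close> and \<open>- c i\<close>; this explains the factor
  2.\<close>

lemma indep_sum_abs_mgf_bound:
  fixes Z :: "'i \<Rightarrow> 'a \<Rightarrow> real"
  assumes I: "finite I" and ind: "indep_vars (\<lambda>_. borel) Z I" and "0 < \<delta>"
    and "\<And>i. i \<in> I \<Longrightarrow> integrable M (\<lambda>\<omega>. exp (\<delta> * \<bar>Z i \<omega>\<bar>))"
    and "\<And>i. i \<in> I \<Longrightarrow> expectation (\<lambda>\<omega>. exp (\<delta> * \<bar>Z i \<omega>\<bar>)) \<le> D"
    and "\<And>i. i \<in> I \<Longrightarrow> expectation (Z i) = 0"
    and "\<And>i. i \<in> I \<Longrightarrow> \<bar>c i\<bar> \<le> \<delta> / 2"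
  shows "integrable M (\<lambda>\<omega>. exp \<bar>\<Sum>i\<in>I. c i * Z i \<omega>\<bar>)"
    and "expectation (\<lambda>\<omega>. exp \<bar>\<Sum>i\<in>I. c i * Z i \<omega>\<bar>) \<le> 2 * exp (8 / \<delta>\<^sup>2 * D * (\<Sum>i\<in>I. (c i)\<^sup>2))"
proof -
  have [measurable]: "random_variable borel (Z i)" if "i \<in> I" for i
    using ind that by (auto simp: indep_vars_def)
  define S where "S \<omega> = (\<Sum>i\<in>I. c i * Z i \<omega>)" for \<omega>
  have [measurable]: "S \<in> borel_measurable M" unfolding S_def by measurable
  have p: "integrable M (\<lambda>\<omega>. exp (S \<omega>))" "expectation (\<lambda>\<omega>. exp (S \<omega>)) \<le> exp (8 / \<delta>\<^sup>2 * D * (\<Sum>i\<in>I. (c i)\<^sup>2))"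
    using indep_sum_mgf_bound[OF I ind, of \<delta> D c] assms by (simp_all add: S_def)
  have m: "integrable M (\<lambda>\<omega>. exp (- S \<omega>))" "expectation (\<lambda>\<omega>. exp (- S \<omega>)) \<le> exp (8 / \<delta>\<^sup>2 * D * (\<Sum>i\<in>I. (c i)\<^sup>2))"
    using indep_sum_mgf_bound[OF I ind, of \<delta> D "\<lambda>i. - c i"] assms by (simp_all add: S_def sum_negf)
  have le: "exp \<bar>S \<omega>\<bar> \<le> exp (S \<omega>) + exp (- S \<omega>)" for \<omega>
    by (auto simp: abs_if)
  have i: "integrable M (\<lambda>\<omega>. exp \<bar>S \<omega>\<bar>)"
    by (rule Bochner_Integration.integrable_bound[OF Bochner_Integration.integrable_add[OF p(1) m(1)]])
       (use le in \<open>auto intro!: AE_I2 simp: abs_of_nonneg\<close>)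
  then show "integrable M (\<lambda>\<omega>. exp \<bar>\<Sum>i\<in>I. c i * Z i \<omega>\<bar>)" by (simp add: S_def)
  have "expectation (\<lambda>\<omega>. exp \<bar>S \<omega>\<bar>) \<le> expectation (\<lambda>\<omega>. exp (S \<omega>) + exp (- S \<omega>))"
    by (intro integral_mono i Bochner_Integration.integrable_add p(1) m(1) le)
  also have "\<dots> \<le> 2 * exp (8 / \<delta>\<^sup>2 * D * (\<Sum>i\<in>I. (c i)\<^sup>2))"
    using p m by simp
  finally show "expectation (\<lambda>\<omega>. exp \<bar>\<Sum>i\<in>I. c i * Z i \<omega>\<bar>) \<le> 2 * exp (8 / \<delta>\<^sup>2 * D * (\<Sum>i\<in>I. (c i)\<^sup>2))"
    by (simp add: S_def)
qed

text \<open>The cross terms vanish by independence and centring. Integrability of the square is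
  proved in the same induction because splitting the expectation requires it.\<close>

lemma indep_centered_sum_second_moment:
  fixes Y :: "'i \<Rightarrow> 'a \<Rightarrow> real"
  assumes "finite I" "indep_vars (\<lambda>_. borel) Y I"
    and "\<And>i. i \<in> I \<Longrightarrow> integrable M (Y i)" "\<And>i. i \<in> I \<Longrightarrow> integrable M (\<lambda>\<omega>. (Y i \<omega>)\<^sup>2)"
    and "\<And>i. i \<in> I \<Longrightarrow> expectation (Y i) = 0"
  shows "integrable M (\<lambda>\<omega>. (\<Sum>i\<in>I. Y i \<omega>)\<^sup>2) \<and>
    expectation (\<lambda>\<omega>. (\<Sum>i\<in>I. Y i \<omega>)\<^sup>2) = (\<Sum>i\<in>I. expectation (\<lambda>\<omega>. (Y i \<omega>)\<^sup>2))"
  using assms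
proof (induction I rule: finite_induct)
  case (insert i I)
  let ?S = "\<lambda>\<omega>. \<Sum>i\<in>I. Y i \<omega>"
  have IH: "integrable M (\<lambda>\<omega>. (?S \<omega>)\<^sup>2)"
    "expectation (\<lambda>\<omega>. (?S \<omega>)\<^sup>2) = (\<Sum>i\<in>I. expectation (\<lambda>\<omega>. (Y i \<omega>)\<^sup>2))"
    using insert.IH insert.prems indep_vars_subset[OF insert.prems(1), of I] by auto
  have ind: "indep_var borel (Y i) borel ?S"
    using insert.hyps insert.prems by (intro indep_vars_sum) auto
  have iS: "integrable M ?S" using insert.prems by (intro Bochner_Integration.integrable_sum) auto
  have iY: "integrable M (Y i)" "integrable M (\<lambda>\<omega>. (Y i \<omega>)\<^sup>2)" "expectation (Y i) = 0"
    using insert.prems by auto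
  have c: "integrable M (\<lambda>\<omega>. Y i \<omega> * ?S \<omega>)" "expectation (\<lambda>\<omega>. Y i \<omega> * ?S \<omega>) = 0"
    using indep_var_integrable[OF ind iY(1) iS] indep_var_lebesgue_integral[OF ind iY(1) iS] iY(3) by auto
  have "(\<lambda>\<omega>. (\<Sum>i\<in>insert i I. Y i \<omega>)\<^sup>2) = (\<lambda>\<omega>. (Y i \<omega>)\<^sup>2 + 2 * (Y i \<omega> * ?S \<omega>) + (?S \<omega>)\<^sup>2)"
    using insert.hyps by (simp add: power2_sum fun_eq_iff)
  then show ?case
    using insert.hyps IH iY c by simp
qed simp

section \<open>The increment of the nearly deterministic queue\<close>

text \<open>The two averages are functions of disjoint blocks of one jointly independent
  family.\<close>

lemma iid_average_indep:
  assumes "iid_copies M V U n Vs Us"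
  shows "indep_var borel (average n Vs) borel (average n Us)"
proof -
  \<comment> \<open>The injection \<open>h\<close> is \<open>Inl\<close> or \<open>Inr\<close> and
    selects the block; \<open>g\<close> is a tuple restricted to that block.\<close>
  let ?f = "\<lambda>h g. (1 / real n) * (\<Sum>k=1..n. g (h k :: nat + nat) :: real)"
  have [simp]: "h k \<in> h ` {1..n}" if "k \<in> {Suc 0..n}" for h :: "nat \<Rightarrow> nat + nat" and k
    using that by auto
  have ind: "indep_vars (\<lambda>_. borel) (case_sum Vs Us) ({1..n} <+> {1..n})"
    using assms by (simp add: iid_copies_def)
  have m: "?f h \<in> measurable (PiM (h ` {1..n}) (\<lambda>_. borel)) borel" for h
    by (intro borel_measurable_times borel_measurable_const borel_measurable_sum measurable_component_singleton) auto
  have "indep_var borel (?f Inl \<circ> (\<lambda>\<omega>. restrict (\<lambda>i. case_sum Vs Us i \<omega>) (Inl ` {1..n})))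
      borel (?f Inr \<circ> (\<lambda>\<omega>. restrict (\<lambda>i. case_sum Vs Us i \<omega>) (Inr ` {1..n})))"
    by (intro indep_var_compose[OF indep_var_restrict[OF ind]] m) auto
  moreover have "?f Inl \<circ> (\<lambda>\<omega>. restrict (\<lambda>i. case_sum Vs Us i \<omega>) (Inl ` {1..n})) = average n Vs"
    by (auto simp: fun_eq_iff average_def intro!: sum.cong)
  moreover have "?f Inr \<circ> (\<lambda>\<omega>. restrict (\<lambda>i. case_sum Vs Us i \<omega>) (Inr ` {1..n})) = average n Us"
    by (auto simp: fun_eq_iff average_def intro!: sum.cong)
  ultimately show ?thesis by simp
qed

text \<open>\<open>X\<close> equals \<open>S - \<epsilon>\<close>, where \<open>S\<close> is a
  weighted sum of all \<open>2 n\<close> centred variables with weights of order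
  \<open>1 / n\<close>. Scaled by \<surd>n, the weights have a bounded sum of squares, so the
  exponential moment of \<open>\<surd>n * \<bar>S\<bar>\<close> is bounded uniformly in
  \<open>n\<close>. The lower bound on \<rho> keeps the weights \<open>1 / (\<rho> n)\<close> below
  \<open>2 / n\<close>.\<close>

lemma increment_moments:
  fixes V U X :: "'a \<Rightarrow> real"
  assumes iid: "iid_copies M V U n Vs Us" and n: "1 \<le> n" and \<rho>: "1 / 2 \<le> \<rho>" "\<rho> < 1" and "0 < \<delta>"
    and [measurable]: "random_variable borel V" "random_variable borel U"
    and EV: "expectation V = 1" and EU: "expectation U = 1"
    and intV: "integrable M (\<lambda>\<omega>. exp (\<delta> * \<bar>V \<omega> - 1\<bar>))" and DV: "expectation (\<lambda>\<omega>. exp (\<delta> * \<bar>V \<omega> - 1\<bar>)) \<le> D"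
    and intU: "integrable M (\<lambda>\<omega>. exp (\<delta> * \<bar>U \<omega> - 1\<bar>))" and DU: "expectation (\<lambda>\<omega>. exp (\<delta> * \<bar>U \<omega> - 1\<bar>)) \<le> D"
    and X: "X = (\<lambda>\<omega>. average n Vs \<omega> - (1 / \<rho>) * average n Us \<omega>)"
  shows "random_variable borel X"
    and "expectation X = - (1 / \<rho> - 1)"
    and "expectation (\<lambda>\<omega>. (X \<omega>)\<^sup>2) = (variance V + (1 / \<rho>\<^sup>2) * variance U) / real n + (1 / \<rho> - 1)\<^sup>2"
    and "integrable M (\<lambda>\<omega>. exp (\<delta> / 4 * sqrt (real n) * \<bar>X \<omega>\<bar>))"
    and "expectation (\<lambda>\<omega>. exp (\<delta> / 4 * sqrt (real n) * \<bar>X \<omega>\<bar>))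
        \<le> 2 * exp (4 * D) * exp (\<delta> / 4 * sqrt (real n) * (1 / \<rho> - 1))"
proof -
  let ?I = "{1..n} <+> {1..n}"
  define Z where "Z i \<omega> = case_sum Vs Us i \<omega> - 1" for i \<omega>
  \<comment> \<open>A representative of the law of the \<open>i\<close>-th summand, so that both
    families are handled by one argument.\<close>
  define A where "A i = (case i of Inl k \<Rightarrow> V | Inr k \<Rightarrow> U)" for i :: "nat + nat"
  define a where "a i = (case i of Inl k \<Rightarrow> 1 / real n | Inr k \<Rightarrow> - (1 / (\<rho> * real n)))" for i :: "nat + nat"
  define \<epsilon> where "\<epsilon> = 1 / \<rho> - 1"
  have \<epsilon>0: "0 \<le> \<epsilon>" using \<rho> by (simp add: \<epsilon>_def field_simps)
  have ind: "indep_vars (\<lambda>_. borel) (case_sum Vs Us) ?I"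
    using iid by (simp add: iid_copies_def)
  have [measurable]: "random_variable borel (case_sum Vs Us i)" if "i \<in> ?I" for i
    using ind that by (auto simp: indep_vars_def)
  have [measurable]: "random_variable borel (A i)" for i
    by (auto simp: A_def split: sum.split)
  have dist: "distr M borel (case_sum Vs Us i) = distr M borel (A i)" if "i \<in> ?I" for i
    using iid that by (auto simp: iid_copies_def A_def)
  have law: "(\<integral>\<omega>. f (case_sum Vs Us i \<omega> - 1) \<partial>M) = (\<integral>\<omega>. f (A i \<omega> - 1) \<partial>M)"
      "integrable M (\<lambda>\<omega>. f (case_sum Vs Us i \<omega> - 1)) \<longleftrightarrow> integrable M (\<lambda>\<omega>. f (A i \<omega> - 1))"
    if i: "i \<in> ?I" and [measurable]: "f \<in> borel_measurable borel" for f :: "real \<Rightarrow> real" and i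
    using i by (intro distr_eq_integral[where f="\<lambda>x. f (x - 1)", OF _ _ _ dist[OF i]]; simp)+
  have Aint: "integrable M (\<lambda>\<omega>. exp (\<delta> * \<bar>A i \<omega> - 1\<bar>))" "expectation (\<lambda>\<omega>. exp (\<delta> * \<bar>A i \<omega> - 1\<bar>)) \<le> D" for i
    using intV intU DV DU by (auto simp: A_def split: sum.split)
  have A1: "integrable M (\<lambda>\<omega>. A i \<omega> - 1)" for i
  proof -
    have "integrable M (\<lambda>\<omega>. \<bar>A i \<omega> - 1\<bar>)"
      using integrable_power_exp(1)[OF _ Aint(1), where c=0 and k=1] \<open>0 < \<delta>\<close> by simp
    then show ?thesis by (rule Bochner_Integration.integrable_bound) auto
  qed
  have A2: "integrable M (\<lambda>\<omega>. (A i \<omega> - 1)\<^sup>2)" for i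
    using integrable_power_exp(1)[OF _ Aint(1), where c=0 and k=2] \<open>0 < \<delta>\<close> by simp
  have EA: "expectation (\<lambda>\<omega>. A i \<omega> - 1) = 0" for i
  proof -
    have "integrable M (\<lambda>\<omega>. (A i \<omega> - 1) + 1)" by (intro Bochner_Integration.integrable_add A1) simp
    then have "expectation (\<lambda>\<omega>. A i \<omega> - 1) = expectation (A i) - 1" by (simp add: prob_space)
    then show ?thesis by (simp add: A_def EV EU split: sum.split)
  qed
  have Zint: "integrable M (\<lambda>\<omega>. exp (\<delta> * \<bar>Z i \<omega>\<bar>))" "expectation (\<lambda>\<omega>. exp (\<delta> * \<bar>Z i \<omega>\<bar>)) \<le> D"
    "integrable M (Z i)" "integrable M (\<lambda>\<omega>. (Z i \<omega>)\<^sup>2)" "expectation (Z i) = 0"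
    "expectation (\<lambda>\<omega>. (Z i \<omega>)\<^sup>2) = expectation (\<lambda>\<omega>. (A i \<omega> - 1)\<^sup>2)" if i: "i \<in> ?I" for i
    unfolding Z_def using Aint[of i] A1[of i] A2[of i] EA[of i]
      law[OF i, of "\<lambda>x. exp (\<delta> * \<bar>x\<bar>)"] law[OF i, of "\<lambda>x. x"] law[OF i, of "\<lambda>x. x\<^sup>2"] by auto
  have indZ: "indep_vars (\<lambda>_. borel) Z ?I"
    unfolding Z_def by (rule indep_vars_compose2[OF ind]) auto
  have indY: "indep_vars (\<lambda>_. borel) (\<lambda>i \<omega>. a i * Z i \<omega>) ?I"
    by (rule indep_vars_compose2[OF indZ]) auto
  define S where "S \<omega> = (\<Sum>i\<in>?I. a i * Z i \<omega>)" for \<omega>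
  have sumI: "(\<Sum>i\<in>?I. g i) = (\<Sum>k=1..n. g (Inl k)) + (\<Sum>k=1..n. g (Inr k))" for g :: "nat + nat \<Rightarrow> real"
    by (subst sum.Plus) (auto simp: comp_def)
  have "S \<omega> = (\<Sum>k=1..n. (1 / real n) * (Vs k \<omega> - 1)) + (\<Sum>k=1..n. - (1 / (\<rho> * real n)) * (Us k \<omega> - 1))" for \<omega>
    unfolding S_def sumI by (simp add: Z_def a_def)
  then have "S \<omega> = (1 / real n) * ((\<Sum>k=1..n. Vs k \<omega>) - real n) - (1 / (\<rho> * real n)) * ((\<Sum>k=1..n. Us k \<omega>) - real n)" for \<omega>
    unfolding sum_distrib_left[symmetric] sum_subtractf by simp
  moreover have "1 / m * v - 1 / \<rho> * (1 / m * u) = 1 / m * (v - m) - 1 / (\<rho> * m) * (u - m) - (1 / \<rho> - 1)"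
    if "m > 0" for m u v :: real
    using that \<rho> by (simp add: field_simps)
  ultimately have XS: "X \<omega> = S \<omega> - \<epsilon>" for \<omega>
    using n by (simp only: X average_def \<epsilon>_def)
  have iS: "integrable M S" "expectation S = 0"
    unfolding S_def using Zint by (auto intro!: Bochner_Integration.integrable_sum)
  have [measurable]: "S \<in> borel_measurable M" using iS(1) by auto
  have X_eq: "X = (\<lambda>\<omega>. S \<omega> - \<epsilon>)" using XS by auto
  show "random_variable borel X" unfolding X_eq by measurable
  show "expectation X = - (1 / \<rho> - 1)" unfolding X_eq using iS by (simp add: prob_space \<epsilon>_def)
  have S2: "integrable M (\<lambda>\<omega>. (S \<omega>)\<^sup>2)" "expectation (\<lambda>\<omega>. (S \<omega>)\<^sup>2) = (\<Sum>i\<in>?I. expectation (\<lambda>\<omega>. (a i * Z i \<omega>)\<^sup>2))"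
    using indep_centered_sum_second_moment[OF _ indY] Zint unfolding S_def by (auto simp: power_mult_distrib)
  have "(\<Sum>i\<in>?I. expectation (\<lambda>\<omega>. (a i * Z i \<omega>)\<^sup>2)) = (\<Sum>i\<in>?I. (a i)\<^sup>2 * expectation (\<lambda>\<omega>. (A i \<omega> - 1)\<^sup>2))"
    using Zint(6) by (intro sum.cong) (auto simp: power_mult_distrib)
  also have "\<dots> = (variance V + (1 / \<rho>\<^sup>2) * variance U) / real n"
    unfolding sumI using n \<rho> by (simp add: a_def A_def EV EU power_divide power_mult_distrib field_simps power2_eq_square)
  finally have ES2: "expectation (\<lambda>\<omega>. (S \<omega>)\<^sup>2) = (variance V + (1 / \<rho>\<^sup>2) * variance U) / real n"
    using S2(2) by simp
  have "expectation (\<lambda>\<omega>. (X \<omega>)\<^sup>2) = expectation (\<lambda>\<omega>. (S \<omega>)\<^sup>2 + \<epsilon>\<^sup>2 - 2 * \<epsilon> * S \<omega>)"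
    by (simp add: XS power2_diff algebra_simps)
  also have "\<dots> = expectation (\<lambda>\<omega>. (S \<omega>)\<^sup>2) + \<epsilon>\<^sup>2"
    using S2(1) iS by (simp add: prob_space)
  finally show "expectation (\<lambda>\<omega>. (X \<omega>)\<^sup>2) = (variance V + (1 / \<rho>\<^sup>2) * variance U) / real n + (1 / \<rho> - 1)\<^sup>2"
    by (simp add: ES2 \<epsilon>_def)
  \<comment> \<open>With weights at most \<open>2 / n\<close> in modulus, each
    \<open>\<bar>h * a i\<bar>\<close> is at most \<open>\<delta> / (2 \<surd>n)\<close>. Hence it
    is within the admissible range \<delta>/2, and the \<open>2 n\<close> squares sum to at most
    \<open>\<delta>^2 / 2\<close>, which turns the exponent \<open>8 / \<delta>^2 * D * ...\<close>
    into \<open>4 * D\<close>.\<close>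
  define h where "h = \<delta> / 4 * sqrt (real n)"
  have h0: "0 < h" using \<open>0 < \<delta>\<close> n by (simp add: h_def)
  have sq: "sqrt (real n) * sqrt (real n) = real n" by simp
  have s1: "1 \<le> sqrt (real n)" using n by simp
  have absa: "\<bar>a i\<bar> \<le> 2 / real n" for i
    using n \<rho> by (auto simp: a_def abs_mult field_simps split: sum.split)
  have ca: "\<bar>h * a i\<bar> \<le> \<delta> / 2 / sqrt (real n)" for i
  proof -
    have "\<bar>h * a i\<bar> \<le> h * (2 / real n)"
      using h0 mult_left_mono[OF absa[of i], of h] by (simp add: abs_mult)
    also have "\<dots> = \<delta> / 2 / sqrt (real n)"
      using n sq by (simp add: h_def field_simps)
    finally show ?thesis .
  qed
  have ca1: "\<bar>h * a i\<bar> \<le> \<delta> / 2" for i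
  proof -
    have "\<delta> / 2 / sqrt (real n) \<le> \<delta> / 2 / 1"
      using s1 \<open>0 < \<delta>\<close> by (intro divide_left_mono) auto
    then show ?thesis using ca[of i] by simp
  qed
  have D0: "0 \<le> D"
    using DV by (rule order_trans[rotated]) (intro Bochner_Integration.integral_nonneg; simp)
  have "(\<Sum>i\<in>?I. (h * a i)\<^sup>2) \<le> (\<Sum>i\<in>?I. (\<delta> / 2 / sqrt (real n))\<^sup>2)"
  proof (rule sum_mono)
    fix i
    have "\<bar>h * a i\<bar>\<^sup>2 \<le> (\<delta> / 2 / sqrt (real n))\<^sup>2" by (rule power_mono[OF ca]) simp
    then show "(h * a i)\<^sup>2 \<le> (\<delta> / 2 / sqrt (real n))\<^sup>2" by simp
  qed
  also have "\<dots> = \<delta>\<^sup>2 / 2"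
    unfolding sumI using n by (simp add: power_divide)
  finally have sumc: "8 / \<delta>\<^sup>2 * D * (\<Sum>i\<in>?I. (h * a i)\<^sup>2) \<le> 8 / \<delta>\<^sup>2 * D * (\<delta>\<^sup>2 / 2)"
    using D0 by (intro mult_left_mono) auto
  also have "\<dots> = 4 * D" using \<open>0 < \<delta>\<close> by simp
  finally have sumc': "exp (8 / \<delta>\<^sup>2 * D * (\<Sum>i\<in>?I. (h * a i)\<^sup>2)) \<le> exp (4 * D)" by simp
  have hS: "(\<Sum>i\<in>?I. h * a i * Z i \<omega>) = h * S \<omega>" for \<omega>
    by (simp add: S_def sum_distrib_left mult.assoc)
  have E1: "integrable M (\<lambda>\<omega>. exp \<bar>h * S \<omega>\<bar>)" "expectation (\<lambda>\<omega>. exp \<bar>h * S \<omega>\<bar>) \<le> 2 * exp (4 * D)"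
    using indep_sum_abs_mgf_bound[where c="\<lambda>i. h * a i", OF _ indZ \<open>0 < \<delta>\<close> Zint(1,2,5) ca1] sumc'
    unfolding hS by (blast intro: finite_Plus, force intro: order_trans)
  have le: "exp (h * \<bar>X \<omega>\<bar>) \<le> exp (h * \<epsilon>) * exp \<bar>h * S \<omega>\<bar>" for \<omega>
  proof -
    have "\<bar>X \<omega>\<bar> \<le> \<epsilon> + \<bar>S \<omega>\<bar>" unfolding XS using \<epsilon>0 by linarith
    then have "h * \<bar>X \<omega>\<bar> \<le> h * (\<epsilon> + \<bar>S \<omega>\<bar>)" using h0 by (intro mult_left_mono) auto
    then show ?thesis using h0 by (simp add: abs_mult distrib_left flip: exp_add)
  qed
  have iE: "integrable M (\<lambda>\<omega>. exp (h * \<epsilon>) * exp \<bar>h * S \<omega>\<bar>)" using E1 by simp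
  have iX: "integrable M (\<lambda>\<omega>. exp (h * \<bar>X \<omega>\<bar>))"
    by (rule Bochner_Integration.integrable_bound[OF iE]) (use le in \<open>auto simp: X_eq abs_mult\<close>)
  then show "integrable M (\<lambda>\<omega>. exp (\<delta> / 4 * sqrt (real n) * \<bar>X \<omega>\<bar>))" by (simp add: h_def)
  have "expectation (\<lambda>\<omega>. exp (h * \<bar>X \<omega>\<bar>)) \<le> expectation (\<lambda>\<omega>. exp (h * \<epsilon>) * exp \<bar>h * S \<omega>\<bar>)"
    by (intro integral_mono iX iE le)
  also have "\<dots> = exp (h * \<epsilon>) * expectation (\<lambda>\<omega>. exp \<bar>h * S \<omega>\<bar>)"
    by simp
  also have "\<dots> \<le> exp (h * \<epsilon>) * (2 * exp (4 * D))"
    by (intro mult_left_mono E1) simp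
  finally show "expectation (\<lambda>\<omega>. exp (\<delta> / 4 * sqrt (real n) * \<bar>X \<omega>\<bar>))
        \<le> 2 * exp (4 * D) * exp (\<delta> / 4 * sqrt (real n) * (1 / \<rho> - 1))"
    by (simp add: h_def \<epsilon>_def mult.commute)
qed

section \<open>An independent coupling of waiting time and increment\<close>

text \<open>Stationarity constrains only the law of \<open>W\<close>, which on \<open>M\<close> may
  depend on \<open>V\<close> and \<open>U\<close>. On the product of the two laws the coordinates
  are independent copies of \<open>W\<close> and of the increment, and they satisfy the Lindley
  recursion in law.\<close>

lemma queue_product_space:
  fixes V U W :: "'a \<Rightarrow> real"
  assumes ind: "indep_var borel V borel U" and st: "steady_state_waiting_time M V U \<rho> W"
  defines "P \<equiv> distr M borel W \<Otimes>\<^sub>M distr M borel (\<lambda>\<omega>. V \<omega> - (1 / \<rho>) * U \<omega>)"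
  shows "prob_space P" and "prob_space.indep_var P borel fst borel snd"
    and "distr P borel fst = distr M borel W"
    and "distr P borel snd = distr M borel (\<lambda>\<omega>. V \<omega> - (1 / \<rho>) * U \<omega>)"
    and "distr P borel fst = distr P borel (\<lambda>p. max 0 (fst p + snd p))"
proof -
  have [measurable]: "random_variable borel V" "random_variable borel U" "random_variable borel W"
    using ind st indep_var_rv1 indep_var_rv2 by (auto simp: steady_state_waiting_time_def)
  let ?X = "\<lambda>\<omega>. V \<omega> - (1 / \<rho>) * U \<omega>"
  let ?A = "distr M borel W" and ?B = "distr M borel ?X"
  have A: "prob_space ?A" and B: "prob_space ?B" by (auto intro!: prob_space_distr)
  interpret A: prob_space ?A by fact
  interpret B: prob_space ?B by fact
  interpret P: pair_prob_space ?A ?B ..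
  show P: "prob_space P" unfolding P_def by (rule P.prob_space_axioms)
  have sP[measurable_cong]: "sets P = sets (borel \<Otimes>\<^sub>M borel)"
    unfolding P_def by (intro sets_pair_measure_cong) auto
  have "distr P ?A fst = ?A" unfolding P_def by (rule B.distr_pair_fst)
  then show f: "distr P borel fst = ?A"
    by (metis distr_cong sets_distr)
  have "distr P ?B snd = ?B"
  proof -
    have "distr P ?B snd = distr (distr (?B \<Otimes>\<^sub>M ?A) (?A \<Otimes>\<^sub>M ?B) (\<lambda>(x, y). (y, x))) ?B snd"
      unfolding P_def by (subst P.distr_pair_swap) simp
    also have "\<dots> = distr (?B \<Otimes>\<^sub>M ?A) ?B fst"
      by (subst distr_distr) (auto simp: comp_def case_prod_beta)
    also have "\<dots> = ?B" by (rule A.distr_pair_fst)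
    finally show ?thesis .
  qed
  then show s: "distr P borel snd = ?B"
    by (metis distr_cong sets_distr)
  show "prob_space.indep_var P borel fst borel snd"
    unfolding prob_space.indep_var_distribution_eq[OF P] f s
  proof (intro conjI)
    show "distr M borel W \<Otimes>\<^sub>M distr M borel ?X = distr P (borel \<Otimes>\<^sub>M borel) (\<lambda>x. (fst x, snd x))"
      unfolding P_def[symmetric] by (simp add: distr_id2 sP)
  qed measurable
  have joint: "distr M borel V \<Otimes>\<^sub>M distr M borel U = distr M (borel \<Otimes>\<^sub>M borel) (\<lambda>\<omega>. (V \<omega>, U \<omega>))"
    using ind unfolding indep_var_distribution_eq by simp
  \<comment> \<open>Pulls a push-forward on the second factor out of the product. It is applied to
    the pair \<open>(V, U)\<close> and to the increment, so that both descriptions of the right-hand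
    side meet on \<open>?A \<Otimes>\<^sub>M M\<close>.\<close>
  have pm: "?A \<Otimes>\<^sub>M distr M N g = distr (?A \<Otimes>\<^sub>M M) (borel \<Otimes>\<^sub>M N) (\<lambda>(w, \<omega>). (w, g \<omega>))"
    if [measurable]: "g \<in> measurable M N" for N :: "'c measure" and g
  proof -
    have "prob_space (distr M N g)" by (rule prob_space_distr) fact
    then have "sigma_finite_measure (distr M N g)"
      by (simp add: prob_space_imp_sigma_finite)
    then have "distr ?A borel (\<lambda>x. x) \<Otimes>\<^sub>M distr M N g = distr (?A \<Otimes>\<^sub>M M) (borel \<Otimes>\<^sub>M N) (\<lambda>(w, \<omega>). (w, g \<omega>))"
      by (intro pair_measure_distr) auto
    then show ?thesis by (simp add: distr_id2)
  qed
  have "?A = distr (?A \<Otimes>\<^sub>M (distr M borel V \<Otimes>\<^sub>M distr M borel U)) borel (\<lambda>(w, v, u). max 0 (w + v - (1 / \<rho>) * u))"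
    using st by (simp add: steady_state_waiting_time_def)
  also have "\<dots> = distr (?A \<Otimes>\<^sub>M M) borel (\<lambda>(w, \<omega>). max 0 (w + ?X \<omega>))"
    unfolding joint by (subst pm) (auto simp: distr_distr comp_def case_prod_unfold add_diff_eq)
  also have "\<dots> = distr P borel (\<lambda>p. max 0 (fst p + snd p))"
    unfolding P_def by (subst pm) (auto simp: distr_distr comp_def case_prod_unfold)
  finally show "distr P borel fst = distr P borel (\<lambda>p. max 0 (fst p + snd p))"
    unfolding f .
qed

end

section \<open>Uniform constants and the limit theorem\<close>

theorem theorem2:
  fixes M :: "'a measure" and V U :: "'a \<Rightarrow> real"
    and Vs Us :: "nat \<Rightarrow> nat \<Rightarrow> 'a \<Rightarrow> real" and W :: "nat \<Rightarrow> 'a \<Rightarrow> real"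
    and \<rho> \<gamma> :: "nat \<Rightarrow> real" and \<delta> \<beta>1 \<beta>2 :: real
  assumes "prob_space M"
    and "V \<in> borel_measurable M" and "U \<in> borel_measurable M"
    and "AE \<omega> in M. 0 \<le> V \<omega>" and "AE \<omega> in M. 0 \<le> U \<omega>"
    and "prob_space.indep_var M borel V borel U"
    and "integrable M V" and "prob_space.expectation M V = 1"
    and "integrable M U" and "prob_space.expectation M U = 1"
    and "integrable M (\<lambda>\<omega>. (V \<omega>)\<^sup>2)" and "integrable M (\<lambda>\<omega>. (U \<omega>)\<^sup>2)"
    and "0 < prob_space.variance M V + prob_space.variance M U"
    and "\<delta> > 0" and "mgf_analytic_on_strip M V \<delta>" and "mgf_analytic_on_strip M U \<delta>"
    and "\<And>n. n \<ge> 1 \<Longrightarrow> 0 < \<rho> n \<and> \<rho> n < 1"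
    and "0 < \<beta>1" and "\<beta>1 \<le> \<beta>2"
    and "\<And>n. n \<ge> 1 \<Longrightarrow> (1 - \<rho> n) * real n \<in> {\<beta>1..\<beta>2}"
    and "\<And>n. n \<ge> 1 \<Longrightarrow> iid_copies M V U n (Vs n) (Us n)"
    and "\<And>n. n \<ge> 1 \<Longrightarrow>
           steady_state_waiting_time M (average n (Vs n)) (average n (Us n)) (\<rho> n) (W n)"
    and "\<And>n. n \<ge> 1 \<Longrightarrow>
           \<gamma> n = gamma_scale (prob_space.variance M V) (prob_space.variance M U) (\<rho> n) n"
  shows "\<forall>T :: complex set. bounded T \<longrightarrow>
    (\<exists>(K::real) (n0::nat). n0 \<ge> 1 \<and>
       (\<forall>n\<ge>n0. \<forall>t\<in>T. Re t \<ge> - 1 / (4 * \<gamma> n) \<longrightarrow>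
          integrable M (\<lambda>\<omega>. exp (- t * complex_of_real (W n \<omega>))) \<and>
          cmod ((\<integral>\<omega>. exp (- t * complex_of_real (W n \<omega>)) \<partial>M)
                 - inverse (1 + complex_of_real (\<gamma> n) * t))
            \<le> K * ln (real n) / sqrt (real n)))"
proof -
  interpret prob_space M by fact
  note [measurable] = assms(2,3)
  define \<sigma> where "\<sigma> = variance V + variance U"
  have \<sigma>: "0 < \<sigma>" using assms(13) by (simp add: \<sigma>_def)
  have var0: "0 \<le> variance V" "0 \<le> variance U" by (auto intro: variance_positive)
  have exp_int: "integrable M (\<lambda>\<omega>. exp (\<delta> * \<bar>Y \<omega> - 1\<bar>))"
    if "mgf_analytic_on_strip M Y \<delta>" "AE \<omega> in M. 0 \<le> Y \<omega>" "random_variable borel Y" for Y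
  proof -
    note [measurable] = that(3)
    \<comment> \<open>The open strip contains the real point \<delta>. Since
      \<open>Y \<ge> 0\<close>, the moment at \<delta> also controls
      \<open>\<bar>Y - 1\<bar> \<le> 1 + Y\<close>.\<close>
    have "integrable M (\<lambda>\<omega>. exp (complex_of_real \<delta> * complex_of_real (Y \<omega>)))"
      using that(1) \<open>\<delta> > 0\<close> by (fastforce simp: mgf_analytic_on_strip_def)
    then have "integrable M (\<lambda>\<omega>. norm (exp (complex_of_real \<delta> * complex_of_real (Y \<omega>))))"
      by (rule integrable_norm)
    then have "integrable M (\<lambda>\<omega>. exp \<delta> * exp (\<delta> * Y \<omega>))"
      by (simp add: norm_exp_eq_Re)
    then show ?thesis
    proof (rule Bochner_Integration.integrable_bound)
      show "AE \<omega> in M. norm (exp (\<delta> * \<bar>Y \<omega> - 1\<bar>)) \<le> norm (exp \<delta> * exp (\<delta> * Y \<omega>))"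
        using that(2)
      proof eventually_elim
        case (elim \<omega>)
        have "\<delta> * \<bar>Y \<omega> - 1\<bar> \<le> \<delta> * (1 + Y \<omega>)"
          using elim \<open>\<delta> > 0\<close> by (intro mult_left_mono) auto
        then show ?case by (simp add: algebra_simps flip: exp_add)
      qed
    qed simp
  qed
  define D where "D = max (expectation (\<lambda>\<omega>. exp (\<delta> * \<bar>V \<omega> - 1\<bar>))) (expectation (\<lambda>\<omega>. exp (\<delta> * \<bar>U \<omega> - 1\<bar>)))"
  \<comment> \<open>Bounds the exponential moment of the scaled increment for all large
    \<open>n\<close>; the last factor covers its drift, as
    \<open>\<epsilon> * \<surd>n \<le> 2 * \<beta>2\<close> below.\<close>
  define C where "C = 2 * exp (4 * D) * exp (\<delta> / 2 * \<beta>2)"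
  show ?thesis
  proof (intro allI impI)
    fix S :: "complex set"
    assume "bounded S"
    then obtain T1 where T1: "\<And>t. t \<in> S \<Longrightarrow> cmod t \<le> T1"
      by (auto simp: bounded_iff)
    \<comment> \<open>Besides the given set, the disc of radius \<open>T\<close> must contain the
      point \<open>- 1 / (4 * \<gamma> n)\<close>, whose modulus is at most
      \<open>\<beta>2 / \<sigma>\<close> for large \<open>n\<close>.\<close>
    define T where "T = max T1 (\<beta>2 / \<sigma>)"
    have \<beta>2: "0 < \<beta>2" using assms by simp
    then have "0 < \<beta>2 / \<sigma>" using \<sigma> by simp
    then have T0: "0 < T" by (simp add: T_def)
    \<comment> \<open>\<open>L\<close> and \<open>K\<close> are the constants of
      \<open>queue_transform_bound\<close> for the rate \<open>\<delta> / 4\<close>,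
      \<open>B = 2 * \<beta>2\<close> and \<open>b = \<beta>1\<close>.\<close>
    define L where "L = T * (2 * \<beta>2) / 2 + 24 * T\<^sup>2 * C / ((\<delta> / 4) ^ 3 * \<beta>1)"
    define K where "K = 2 * (T * (4 * exp (4 * T / (\<delta> / 4)) / (\<delta> / 4) + 8 * C / ((\<delta> / 4)\<^sup>2 * \<beta>1))) + 3 * L"
    have C0: "0 \<le> C" by (simp add: C_def)
    have K0: "0 \<le> K" unfolding K_def L_def using T0 C0 \<beta>2 \<open>\<delta> > 0\<close> \<open>0 < \<beta>1\<close> by simp
    \<comment> \<open>A lower bound for \<surd>n. Its entries give, in order,
      \<open>1 \<le> ln r\<close>, \<open>1/2 \<le> \<rho> n\<close>,
      \<open>4 * T \<le> \<delta> / 4 * r\<close>, and a relative error of at most 1/4.\<close>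
    define R where "R = Max {exp 1, 2 * \<beta>2, 4 * T / (\<delta> / 4), 4 * L}"
    define n0 where "n0 = max 1 (nat \<lceil>R\<^sup>2\<rceil>)"
    have main: "integrable M (\<lambda>\<omega>. exp (- t * complex_of_real (W n \<omega>))) \<and>
          cmod ((\<integral>\<omega>. exp (- t * complex_of_real (W n \<omega>)) \<partial>M)
                 - inverse (1 + complex_of_real (\<gamma> n) * t)) \<le> K * ln (real n) / sqrt (real n)"
      if n: "n \<ge> n0" and t: "t \<in> S" "Re t \<ge> - 1 / (4 * \<gamma> n)" for n t
    proof -
      have n1: "1 \<le> n" using n by (simp add: n0_def)
      define r where "r = sqrt (real n)"
      have r2: "r\<^sup>2 = real n" by (simp add: r_def)
      have r1: "1 \<le> r" using n1 by (simp add: r_def)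
      have "R\<^sup>2 \<le> real n" using n by (simp add: n0_def)
      then have "R \<le> r" by (simp add: r_def real_le_rsqrt)
      then have R: "exp 1 \<le> r" "2 * \<beta>2 \<le> r" "4 * T / (\<delta> / 4) \<le> r" "4 * L \<le> r"
        by (auto simp: R_def)
      have "ln (exp 1) \<le> ln r" using R(1) r1 by (subst ln_le_cancel_iff) auto
      then have lnr: "1 \<le> ln r" by simp
      define \<epsilon> where "\<epsilon> = 1 / \<rho> n - 1"
      have \<rho>: "0 < \<rho> n" "\<rho> n < 1" using assms(17)[OF n1] by auto
      have \<beta>: "\<beta>1 \<le> (1 - \<rho> n) * real n" "(1 - \<rho> n) * real n \<le> \<beta>2"
        using assms(20)[OF n1] by auto
      have "r * 1 \<le> r * r" using r1 by (intro mult_left_mono) auto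
      then have "2 * \<beta>2 \<le> real n" using R(2) r2 by (simp add: power2_eq_square)
      then have "(1 - \<rho> n) * (2 * \<beta>2) \<le> (1 - \<rho> n) * real n"
        using \<rho> by (intro mult_left_mono) auto
      then have "(1 - \<rho> n) * (2 * \<beta>2) \<le> 1 * \<beta>2" using \<beta> by linarith
      then have "(1 - \<rho> n) * 2 * \<beta>2 \<le> 1 * \<beta>2" by (simp only: mult.assoc)
      then have \<rho>2: "1 / 2 \<le> \<rho> n" using \<beta>2 by (simp only: mult_le_cancel_right) auto
      have \<epsilon>0: "0 < \<epsilon>" using \<rho> by (simp add: \<epsilon>_def field_simps)
      have \<epsilon>eq: "\<epsilon> = (1 - \<rho> n) / \<rho> n" using \<rho> by (simp add: \<epsilon>_def field_simps)
      have "(1 - \<rho> n) / 1 \<le> \<epsilon>" "\<epsilon> \<le> (1 - \<rho> n) / (1 / 2)"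
        unfolding \<epsilon>eq using \<rho> \<rho>2 by (intro divide_left_mono; simp)+
      then have "1 - \<rho> n \<le> \<epsilon>" "\<epsilon> \<le> 2 * (1 - \<rho> n)" by simp_all
      then have "(1 - \<rho> n) * real n \<le> \<epsilon> * real n" "\<epsilon> * real n \<le> 2 * (1 - \<rho> n) * real n"
        by (intro mult_right_mono; simp)+
      then have \<epsilon>n: "\<beta>1 \<le> \<epsilon> * real n" "\<epsilon> * real n \<le> 2 * \<beta>2"
        using \<beta> by linarith+
      have "\<epsilon> * r \<le> \<epsilon> * (r * r)" using r1 \<epsilon>0 by (intro mult_left_mono) auto
      then have \<epsilon>r: "\<epsilon> * r \<le> 2 * \<beta>2" using \<epsilon>n(2) r2 by (simp add: power2_eq_square)
      define s2 where "s2 = variance V + (1 / (\<rho> n)\<^sup>2) * variance U"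
      have "1 * variance U \<le> (1 / (\<rho> n)\<^sup>2) * variance U"
        using \<rho> var0 by (intro mult_right_mono) (auto simp: power_le_one)
      then have s2: "\<sigma> \<le> s2" by (simp add: s2_def \<sigma>_def)
      \<comment> \<open>With \<open>\<epsilon> = (1 - \<rho> n) / \<rho> n\<close>, the given scale
        is the variance \<open>s2 / n\<close> of the increment divided by 2\<epsilon>, the form that
        the single-queue estimate expects.\<close>
      have \<gamma>: "\<gamma> n = s2 / (2 * (\<epsilon> * real n))"
        unfolding assms(23)[OF n1] gamma_scale_def \<epsilon>eq s2_def using \<rho> n1 by (simp add: field_simps)
      have \<epsilon>n0: "0 < \<epsilon> * real n" using \<epsilon>0 n1 by simp
      have \<gamma>0: "0 < \<gamma> n" unfolding \<gamma> using s2 \<sigma> \<epsilon>n0 by (intro divide_pos_pos) auto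
      have "1 / (4 * \<gamma> n) = (\<epsilon> * real n) / (2 * s2)"
        unfolding \<gamma> by simp
      also have "\<dots> \<le> (2 * \<beta>2) / (2 * \<sigma>)"
        using \<epsilon>n \<epsilon>n0 s2 \<sigma> \<beta>2 by (intro frac_le) auto
      finally have \<gamma>T: "1 / (4 * \<gamma> n) \<le> T" by (simp add: T_def)
      define X where "X = (\<lambda>\<omega>. average n (Vs n) \<omega> - (1 / \<rho> n) * average n (Us n) \<omega>)"
      note iid = assms(21)[OF n1]
      note st = assms(22)[OF n1]
      have [measurable]: "random_variable borel (W n)"
        using st by (simp add: steady_state_waiting_time_def)
      have D: "expectation (\<lambda>\<omega>. exp (\<delta> * \<bar>V \<omega> - 1\<bar>)) \<le> D" "expectation (\<lambda>\<omega>. exp (\<delta> * \<bar>U \<omega> - 1\<bar>)) \<le> D"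
        by (simp_all add: D_def)
      note inc = increment_moments[OF iid n1 \<rho>2 \<rho>(2) \<open>\<delta> > 0\<close> assms(2,3,8,10)
          exp_int[OF assms(15,4,2)] D(1) exp_int[OF assms(16,5,3)] D(2) X_def, folded \<epsilon>_def s2_def r_def]
      have [measurable]: "random_variable borel X"
        and EX: "expectation X = - \<epsilon>"
        and EX2: "expectation (\<lambda>\<omega>. (X \<omega>)\<^sup>2) = s2 / real n + \<epsilon>\<^sup>2"
        and iX: "integrable M (\<lambda>\<omega>. exp (\<delta> / 4 * r * \<bar>X \<omega>\<bar>))"
        and EXexp: "expectation (\<lambda>\<omega>. exp (\<delta> / 4 * r * \<bar>X \<omega>\<bar>)) \<le> 2 * exp (4 * D) * exp (\<delta> / 4 * r * \<epsilon>)"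
        by (fact inc)+
      have "\<delta> / 4 * r * \<epsilon> \<le> \<delta> / 2 * \<beta>2"
        using mult_left_mono[OF \<epsilon>r, of "\<delta> / 4"] \<open>\<delta> > 0\<close> by (simp add: ac_simps)
      then have "2 * exp (4 * D) * exp (\<delta> / 4 * r * \<epsilon>) \<le> C"
        by (simp add: C_def)
      then have EXC: "expectation (\<lambda>\<omega>. exp (\<delta> / 4 * r * \<bar>X \<omega>\<bar>)) \<le> C"
        using EXexp by linarith
      have EX2': "expectation (\<lambda>\<omega>. (X \<omega>)\<^sup>2) = 2 * \<epsilon> * \<gamma> n + \<epsilon>\<^sup>2"
        unfolding EX2 \<gamma> using \<epsilon>0 n1 by simp
      \<comment> \<open>The estimate is proved on the product space and carried back to
        \<open>M\<close>; the transform depends only on the law of \<open>W n\<close>.\<close>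
      define P where "P = distr M borel (W n) \<Otimes>\<^sub>M distr M borel X"
      note Q = queue_product_space[OF iid_average_indep[OF iid] st, folded X_def, folded P_def]
      have m: "fst \<in> borel_measurable P" "snd \<in> borel_measurable P"
        using prob_space.indep_var_rv1[OF Q(1,2)] prob_space.indep_var_rv2[OF Q(1,2)] by auto
      note trW = distr_eq_integral[OF m(1) _ _ Q(3)]
      note trX = distr_eq_integral[OF m(2) _ _ Q(4)]
      have fst0: "AE p in P. 0 \<le> fst p"
      proof -
        have "AE w in distr M borel (W n). 0 \<le> w"
          using st by (simp add: AE_distr_iff steady_state_waiting_time_def)
        then have "AE w in distr P borel fst. 0 \<le> w" unfolding Q(3) .
        then show ?thesis using m(1) by (simp add: AE_distr_iff)
      qed
      have PX: "(\<integral>p. snd p \<partial>P) = - \<epsilon>"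
          "(\<integral>p. (snd p)\<^sup>2 \<partial>P) = 2 * \<epsilon> * \<gamma> n + \<epsilon>\<^sup>2"
          "integrable P (\<lambda>p. exp (\<delta> / 4 * r * \<bar>snd p\<bar>))"
          "(\<integral>p. exp (\<delta> / 4 * r * \<bar>snd p\<bar>) \<partial>P) \<le> C"
      proof -
        show "(\<integral>p. snd p \<partial>P) = - \<epsilon>"
          unfolding EX[symmetric] by (rule trX(1)[where f="\<lambda>x. x"]) measurable
        show "(\<integral>p. (snd p)\<^sup>2 \<partial>P) = 2 * \<epsilon> * \<gamma> n + \<epsilon>\<^sup>2"
          unfolding EX2'[symmetric] by (rule trX(1)[where f="\<lambda>x. x\<^sup>2"]) measurable
        show "integrable P (\<lambda>p. exp (\<delta> / 4 * r * \<bar>snd p\<bar>))"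
          by (rule trX(2)[where f="\<lambda>x. exp (\<delta> / 4 * r * \<bar>x\<bar>)", THEN iffD2]) (measurable, rule iX)
        have "(\<integral>p. exp (\<delta> / 4 * r * \<bar>snd p\<bar>) \<partial>P) = expectation (\<lambda>\<omega>. exp (\<delta> / 4 * r * \<bar>X \<omega>\<bar>))"
          by (rule trX(1)[where f="\<lambda>x. exp (\<delta> / 4 * r * \<bar>x\<bar>)"]) measurable
        then show "(\<integral>p. exp (\<delta> / 4 * r * \<bar>snd p\<bar>) \<partial>P) \<le> C"
          using EXC by (rule ord_eq_le_trans)
      qed
      have par: "0 < \<delta> / 4" "0 < r" "\<beta>1 \<le> \<epsilon> * r\<^sup>2" "4 * T \<le> \<delta> / 4 * r" "cmod t \<le> T"
        using \<open>\<delta> > 0\<close> r1 \<epsilon>n r2 R(3) T1[OF t(1)] by (simp_all add: field_simps T_def)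
      note B = prob_space.queue_transform_bound[OF Q(1,2,5) fst0 PX \<epsilon>0 \<gamma>0 par(1) lnr \<open>0 < \<beta>1\<close> par(2,3)
          \<epsilon>r \<gamma>T par(4) R(4)[unfolded L_def] par(5) t(2), folded L_def, folded K_def]
      have "K * ln r / r \<le> K * ln (real n) / r"
      proof -
        have "r * 1 \<le> r * r" using r1 by (intro mult_left_mono) auto
        then have "r \<le> real n" using r2 by (simp add: power2_eq_square)
        then show ?thesis using r1 K0 by (intro divide_right_mono mult_left_mono) auto
      qed
      then have bound: "cmod ((\<integral>p. exp (- t * complex_of_real (fst p)) \<partial>P)
          - inverse (1 + complex_of_real (\<gamma> n) * t)) \<le> K * ln (real n) / r"
        using B(2) by (rule order_trans[rotated])
      have "(\<integral>p. exp (- t * complex_of_real (fst p)) \<partial>P) = (\<integral>\<omega>. exp (- t * complex_of_real (W n \<omega>)) \<partial>M)"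
        by (rule trW(1)[where f="\<lambda>w. exp (- t * complex_of_real w)"]) measurable
      moreover have "integrable M (\<lambda>\<omega>. exp (- t * complex_of_real (W n \<omega>)))"
        by (rule trW(2)[where f="\<lambda>w. exp (- t * complex_of_real w)", THEN iffD1]) (measurable, rule B(1))
      ultimately show ?thesis using bound unfolding r_def by simp
    qed
    show "\<exists>(K::real) (n0::nat). n0 \<ge> 1 \<and>
       (\<forall>n\<ge>n0. \<forall>t\<in>S. Re t \<ge> - 1 / (4 * \<gamma> n) \<longrightarrow>
          integrable M (\<lambda>\<omega>. exp (- t * complex_of_real (W n \<omega>))) \<and>
          cmod ((\<integral>\<omega>. exp (- t * complex_of_real (W n \<omega>)) \<partial>M)
                 - inverse (1 + complex_of_real (\<gamma> n) * t))
            \<le> K * ln (real n) / sqrt (real n))"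
      using main by (intro exI[of _ K] exI[of _ n0]) (auto simp: n0_def)
  qed
qed

end
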